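(* Let $\mathcal{A}$ be a decision problem on pairs of inputs $a,b$ of length $n$ that can be decided in $\mathsf{NSPACE}[\mathrm{polylog}(n)]$. Then $\mathcal{A}$-Satisfying-Pair, on two sets of $N$ strings of length $2^{(\log N)^{o(1)}}$, can be reduced in near-linear time ($N^{1+o(1)}$) to BP-Satisfying-Pair on a branching program of size $2^{(\log N)^{o(1)}}$.
   Context: $\mathcal{A}$-Satisfying-Pair: given two sets $A,B$ of $N$ strings, decide whether there is $(a,b)\in A\times B$ such that $(a,b)$ is a yes-instance of $\mathcal{A}$. A (nondeterministic) branching program (BP) of length $T$ and width $W$ on Boolean inputs $x_1,\dots,x_n$ is a layered directed graph with $T$ layers of $W$ nodes; all nodes of layer $i<T$ are labelled by one variable $x_{f(i)}$; edges go between consecutive layers and are marked $0$ or $1$; its size is the number of edges ($O(W^2T)$); it accepts $x$ iff there is a path from the first node of layer $1$ to the first node of layer $T$ using only edges whose mark equals the value of the variable labelling their starting node. BP-Satisfying-Pair: given a BP $P$ on $n$ inputs and two sets $A,B\subseteq\{0,1\}^{n/2}$ of $N$ strings, decide whether $P$ accepts the concatenation of some $a\in A$ and $b\in B$. *)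

theory Defs
  imports Complex_Main "HOL-Library.Log_Nat"
begin

section \<open>Nondeterministic space\<close>

text \<open>
  Off-line nondeterministic Turing machines: a two-way read-only input tape holding a binary
  string between end markers, and one semi-infinite read/write work tape. States and work symbols
  are natural numbers, the blank work symbol is 0. A transition
  \<open>(q, s, g, q', g', d, d')\<close> applies in state \<open>q\<close> when \<open>s\<close> is scanned on the input tape and
  \<open>g\<close> on the work tape; it enters \<open>q'\<close>, overwrites \<open>g\<close> by \<open>g'\<close> and moves the input head by \<open>d\<close>
  and the work head by \<open>d'\<close>. As the transition relation is finite, only finitely many states
  and symbols occur.
\<close>

datatype insym = LeftEnd | Bit bool | RightEnd

datatype dir = MoveL | Stay | MoveR

record ntm =
  ntm_start :: nat
  ntm_accept :: nat
  ntm_delta :: "(nat \<times> insym \<times> nat \<times> nat \<times> nat \<times> dir \<times> dir) set"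

definition wf_ntm :: "ntm \<Rightarrow> bool" where
  "wf_ntm M \<longleftrightarrow> finite (ntm_delta M)"

text \<open>Configurations: state, input head position, work head position, work tape contents.\<close>

type_synonym ntm_conf = "nat \<times> nat \<times> nat \<times> (nat \<Rightarrow> nat)"

definition input_at :: "bool list \<Rightarrow> nat \<Rightarrow> insym" where
  "input_at x i =
     (if i = 0 then LeftEnd else if i \<le> length x then Bit (x ! (i - 1)) else RightEnd)"

fun move :: "dir \<Rightarrow> nat \<Rightarrow> nat" where
  "move MoveL i = i - 1"
| "move Stay i = i"
| "move MoveR i = i + 1"

definition ntm_init :: "ntm \<Rightarrow> ntm_conf" where
  "ntm_init M = (ntm_start M, 0, 0, \<lambda>_. 0)"

text \<open>The input head is confined to the input and its two end markers.\<close>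

inductive ntm_step :: "ntm \<Rightarrow> bool list \<Rightarrow> ntm_conf \<Rightarrow> ntm_conf \<Rightarrow> bool"
  for M :: ntm and x :: "bool list" where
  "(q, input_at x i, w h, q', g', d, d') \<in> ntm_delta M \<Longrightarrow>
   ntm_step M x (q, i, h, w) (q', min (move d i) (length x + 1), move d' h, w(h := g'))"

definition ntm_reachable :: "ntm \<Rightarrow> bool list \<Rightarrow> ntm_conf \<Rightarrow> bool" where
  "ntm_reachable M x c \<longleftrightarrow> (ntm_step M x)\<^sup>*\<^sup>* (ntm_init M) c"

definition ntm_accepts :: "ntm \<Rightarrow> bool list \<Rightarrow> bool" where
  "ntm_accepts M x \<longleftrightarrow> (\<exists>i h w. ntm_reachable M x (ntm_accept M, i, h, w))"

text \<open>
  Only work tape cells count as space. The work head starts on cell 0 and moves by single steps,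
  so a computation visits at most \<open>S\<close> cells iff all its work head positions \<open>h\<close>
  satisfy \<open>h + 1 \<le> S\<close>. The bound is imposed on all computations.
\<close>

definition NSPACE :: "(nat \<Rightarrow> real) \<Rightarrow> bool list set set" where
  "NSPACE s = {L. \<exists>M. wf_ntm M \<and> (\<forall>x. x \<in> L \<longleftrightarrow> ntm_accepts M x) \<and>
     (\<forall>x q i h w. ntm_reachable M x (q, i, h, w) \<longrightarrow> real (h + 1) \<le> s (length x))}"

definition NSPACE_polylog :: "bool list set set" where
  "NSPACE_polylog = (\<Union>(k::nat) (c::nat). NSPACE (\<lambda>n. real c * (log 2 (real n)) ^ k + real c))"

text \<open>
  The two inputs have equal length, so the concatenation determines the pair.
\<close>

definition pair_language :: "(bool list \<Rightarrow> bool list \<Rightarrow> bool) \<Rightarrow> bool list set" where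
  "pair_language R = {a @ b | a b. length a = length b \<and> R a b}"

section \<open>Branching programs\<close>

text \<open>
  Layers, nodes in a layer, and variables are numbered from 0. An edge \<open>(i, u, v, m)\<close> leads from
  node \<open>u\<close> of layer \<open>i\<close> to node \<open>v\<close> of layer \<open>i + 1\<close> and carries the mark \<open>m\<close>.
\<close>

record bp =
  bp_inputs :: nat
  bp_length :: nat
  bp_width :: nat
  bp_label :: "nat \<Rightarrow> nat"
  bp_edges :: "(nat \<times> nat \<times> nat \<times> bool) set"

definition wf_bp :: "bp \<Rightarrow> bool" where
  "wf_bp P \<longleftrightarrow> 1 \<le> bp_length P \<and> 1 \<le> bp_width P \<and>
     (\<forall>i. i + 1 < bp_length P \<longrightarrow> bp_label P i < bp_inputs P) \<and>
     (\<forall>(i, u, v, m) \<in> bp_edges P. i + 1 < bp_length P \<and> u < bp_width P \<and> v < bp_width P)"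

definition bp_size :: "bp \<Rightarrow> nat" where
  "bp_size P = card (bp_edges P)"

definition bp_accepts :: "bp \<Rightarrow> bool list \<Rightarrow> bool" where
  "bp_accepts P x \<longleftrightarrow> (\<exists>p :: nat \<Rightarrow> nat. p 0 = 0 \<and> p (bp_length P - 1) = 0 \<and>
     (\<forall>i. i + 1 < bp_length P \<longrightarrow> (i, p i, p (i + 1), x ! bp_label P i) \<in> bp_edges P))"

section \<open>Satisfying-Pair problems and their encodings\<close>

definition satisfying_pair ::
    "(bool list \<Rightarrow> bool list \<Rightarrow> bool) \<Rightarrow> bool list set \<Rightarrow> bool list set \<Rightarrow> bool" where
  "satisfying_pair R A B \<longleftrightarrow> (\<exists>a\<in>A. \<exists>b\<in>B. R a b)"

definition bp_satisfying_pair :: "bp \<Rightarrow> bool list set \<Rightarrow> bool list set \<Rightarrow> bool" where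
  "bp_satisfying_pair P A B \<longleftrightarrow> satisfying_pair (\<lambda>a b. bp_accepts P (a @ b)) A B"

definition string_set :: "nat \<Rightarrow> nat \<Rightarrow> bool list set \<Rightarrow> bool" where
  "string_set N n A \<longleftrightarrow> finite A \<and> card A = N \<and> (\<forall>a\<in>A. length a = n)"

definition bits :: "bool list list \<Rightarrow> nat list" where
  "bits as = map of_bool (concat as)"

text \<open>
  A set of strings is presented by listing its elements, without repetition, in any order.
\<close>

definition encodes_sets ::
    "nat \<Rightarrow> nat \<Rightarrow> bool list set \<Rightarrow> bool list set \<Rightarrow> nat list \<Rightarrow> bool" where
  "encodes_sets N n A B xs \<longleftrightarrow> string_set N n A \<and> string_set N n B \<and>
     (\<exists>as bs. distinct as \<and> set as = A \<and> distinct bs \<and> set bs = B \<and>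
        xs = [N, n] @ bits as @ bits bs)"

text \<open>
  A branching program is presented by its parameters, the labels of its layers, and the adjacency
  matrices between consecutive layers (one for each mark).
\<close>

definition bp_code :: "bp \<Rightarrow> nat list" where
  "bp_code P =
     [bp_inputs P, bp_length P, bp_width P] @
     map (bp_label P) [0..<bp_length P - 1] @
     [of_bool ((i, u, v, m) \<in> bp_edges P).
        i \<leftarrow> [0..<bp_length P - 1], u \<leftarrow> [0..<bp_width P], v \<leftarrow> [0..<bp_width P],
        m \<leftarrow> [False, True]]"

definition encodes_bp_sets ::
    "nat \<Rightarrow> bp \<Rightarrow> bool list set \<Rightarrow> bool list set \<Rightarrow> nat list \<Rightarrow> bool" where
  "encodes_bp_sets N P A B ys \<longleftrightarrow> wf_bp P \<and>
     (\<exists>m zs. bp_inputs P = 2 * m \<and> encodes_sets N m A B zs \<and> ys = bp_code P @ zs)"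

section \<open>Random access machines with logarithmic cost\<close>

text \<open>
  The random access machine of Aho, Hopcroft and Ullman, over the natural numbers and with
  three-address instructions. Register operands are memory addresses; \<open>Load i j\<close> is
  \<open>r\<^sub>i := mem[r\<^sub>j]\<close> and \<open>Store i j\<close> is \<open>mem[r\<^sub>i] := r\<^sub>j\<close>, with registers and memory being the same
  store. \<open>Sub\<close> is truncated, division by 0 gives 0, reading past the end of the input gives 0.
  The machine halts when the program counter leaves the program.
\<close>

datatype instr =
    Const nat nat
  | Add nat nat nat
  | Sub nat nat nat
  | Mul nat nat nat
  | Div nat nat nat
  | Load nat nat
  | Store nat nat
  | Read nat
  | Write nat
  | Jump nat
  | JZero nat nat

text \<open>Configurations: program counter, memory, remaining input, output so far.\<close>

type_synonym ram_conf = "nat \<times> (nat \<Rightarrow> nat) \<times> nat list \<times> nat list"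

fun ram_instr :: "instr \<Rightarrow> ram_conf \<Rightarrow> ram_conf" where
  "ram_instr (Const i c) (pc, r, inp, out) = (pc + 1, r(i := c), inp, out)"
| "ram_instr (Add i j k) (pc, r, inp, out) = (pc + 1, r(i := r j + r k), inp, out)"
| "ram_instr (Sub i j k) (pc, r, inp, out) = (pc + 1, r(i := r j - r k), inp, out)"
| "ram_instr (Mul i j k) (pc, r, inp, out) = (pc + 1, r(i := r j * r k), inp, out)"
| "ram_instr (Div i j k) (pc, r, inp, out) = (pc + 1, r(i := r j div r k), inp, out)"
| "ram_instr (Load i j) (pc, r, inp, out) = (pc + 1, r(i := r (r j)), inp, out)"
| "ram_instr (Store i j) (pc, r, inp, out) = (pc + 1, r(r i := r j), inp, out)"
| "ram_instr (Read i) (pc, r, inp, out) =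
     (pc + 1, r(i := (case inp of [] \<Rightarrow> 0 | v # _ \<Rightarrow> v)), tl inp, out)"
| "ram_instr (Write j) (pc, r, inp, out) = (pc + 1, r, inp, out @ [r j])"
| "ram_instr (Jump l) (pc, r, inp, out) = (l, r, inp, out)"
| "ram_instr (JZero j l) (pc, r, inp, out) = (if r j = 0 then l else pc + 1, r, inp, out)"

text \<open>
  Logarithmic cost: an instruction is charged the bit lengths of all operands and addresses it
  involves, where 0 has length 1.
\<close>

definition len :: "nat \<Rightarrow> nat" where
  "len v = max 1 (floorlog 2 v)"

fun instr_cost :: "instr \<Rightarrow> ram_conf \<Rightarrow> nat" where
  "instr_cost (Const i c) (pc, r, inp, out) = len i + len c"
| "instr_cost (Add i j k) (pc, r, inp, out) = len i + len j + len k + len (r j) + len (r k)"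
| "instr_cost (Sub i j k) (pc, r, inp, out) = len i + len j + len k + len (r j) + len (r k)"
| "instr_cost (Mul i j k) (pc, r, inp, out) = len i + len j + len k + len (r j) + len (r k)"
| "instr_cost (Div i j k) (pc, r, inp, out) = len i + len j + len k + len (r j) + len (r k)"
| "instr_cost (Load i j) (pc, r, inp, out) = len i + len j + len (r j) + len (r (r j))"
| "instr_cost (Store i j) (pc, r, inp, out) = len i + len j + len (r i) + len (r j)"
| "instr_cost (Read i) (pc, r, inp, out) =
     len i + len (case inp of [] \<Rightarrow> 0 | v # _ \<Rightarrow> v)"
| "instr_cost (Write j) (pc, r, inp, out) = len j + len (r j)"
| "instr_cost (Jump l) (pc, r, inp, out) = 1"
| "instr_cost (JZero j l) (pc, r, inp, out) = len j + len (r j)"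

inductive ram_exec :: "instr list \<Rightarrow> ram_conf \<Rightarrow> nat \<Rightarrow> ram_conf \<Rightarrow> bool"
  for p :: "instr list" where
  refl: "ram_exec p c 0 c"
| step: "fst c < length p \<Longrightarrow> ram_exec p (ram_instr (p ! fst c) c) t c' \<Longrightarrow>
         ram_exec p c (instr_cost (p ! fst c) c + t) c'"

text \<open>On input \<open>xs\<close> the program \<open>p\<close> halts with output \<open>ys\<close> after total cost \<open>t\<close>.\<close>

definition ram_computes :: "instr list \<Rightarrow> nat list \<Rightarrow> nat list \<Rightarrow> nat \<Rightarrow> bool" where
  "ram_computes p xs ys t \<longleftrightarrow>
     (\<exists>pc r inp. ram_exec p (0, \<lambda>_. 0, xs, []) t (pc, r, inp, ys) \<and> length p \<le> pc)"

section \<open>Growth rates\<close>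

text \<open>\<open>f(N) = 2\<^bsup>(log N)\<^bsup>o(1)\<^esup>\<^esup>\<close> and \<open>f(N) = N\<^bsup>1+o(1)\<^esup>\<close>, as asymptotic upper bounds.\<close>

definition exp_log_o1 :: "(nat \<Rightarrow> real) \<Rightarrow> bool" where
  "exp_log_o1 f \<longleftrightarrow> (\<exists>\<epsilon> :: nat \<Rightarrow> real. \<epsilon> \<longlonglongrightarrow> 0 \<and>
     (\<forall>\<^sub>F N in sequentially. f N \<le> 2 powr (log 2 (real N) powr \<epsilon> N)))"

definition near_linear :: "(nat \<Rightarrow> real) \<Rightarrow> bool" where
  "near_linear f \<longleftrightarrow> (\<exists>\<epsilon> :: nat \<Rightarrow> real. \<epsilon> \<longlonglongrightarrow> 0 \<and>
     (\<forall>\<^sub>F N in sequentially. f N \<le> real N powr (1 + \<epsilon> N)))"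

end

theory Submission
  imports Defs "HOL-Real_Asymp.Real_Asymp"
begin

text \<open>
  On inputs \<open>a @ b\<close> of length \<open>2 * n\<close> the machine uses \<open>S = polylog n\<close> cells, so it has at most
  \<open>W = 2\<^bsup>polylog n\<^esup>\<close> configurations and an accepting run of at most \<open>W\<^sup>2\<close> steps. The branching
  program has the configurations as nodes and sweeps over all variables again and again: in a layer
  that reads variable \<open>j\<close>, configurations with input head on cell \<open>j\<close> may make a step, and all
  configurations may stall. Padding the strings to \<open>False # a\<close> and \<open>b @ [False]\<close> gives the two end
  markers variables of their own, so that variable \<open>j\<close> is cell \<open>j\<close> of the input tape, and takes
  care of \<open>n = 0\<close>.

  A configuration is coded by one number with four digits in a large base (state, input head,
  \<open>G\<close> to the power of the work head position, tape contents in base \<open>G\<close>). The edge relation is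
  then an arithmetic expression in the numbers of the two nodes, and the random access machine
  prints the adjacency matrices with a constant number of registers, before it copies the strings.
  With \<open>n = 2\<^bsup>(log N)\<^bsup>o(1)\<^esup>\<^esup>\<close> everything polynomial in \<open>W\<close> is \<open>2\<^bsup>(log N)\<^bsup>o(1)\<^esup>\<^esup>\<close>.
\<close>

section \<open>A small imperative language and its compilation\<close>

text \<open>The program is quantified before \<open>N\<close>, so one machine has to work out all
  parameters of the branching program from the numbers \<open>N\<close> and \<open>n\<close> in its
  input. Hence the generous shapes of \<open>radix\<close>, \<open>width\<close> and
  \<open>layers\<close>: a few arithmetic instructions produce them, and a polynomial loss in size
  only changes the constant \<open>C\<close> in a bound \<open>2 powr (C * y ^ (k + 1))\<close>,
  where \<open>n \<le> 2 powr y\<close>. The edge relation never tests whether a number codes a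
  configuration. Other numbers may have meaningless edges, but no path from the source meets them
  before acceptance is established. Logarithmic cost is controlled by one bound \<open>X\<close> on
  all variables. Values of expressions stay below \<open>X ^ Z\<close>, where \<open>Z\<close> is
  the constant size of the program, so every instruction costs \<open>O(log X)\<close>. Only the two
  copying loops make \<open>N\<close> iterations; all other work is \<open>N powr o(1)\<close>,
  whatever its degree in the number of layers.\<close>

datatype aop = Plus | Minus | Times | Divide

fun apply_op :: "aop \<Rightarrow> nat \<Rightarrow> nat \<Rightarrow> nat" where
  "apply_op Plus a b = a + b"
| "apply_op Minus a b = a - b"
| "apply_op Times a b = a * b"
| "apply_op Divide a b = a div b"

fun op_instr :: "aop \<Rightarrow> nat \<Rightarrow> nat \<Rightarrow> nat \<Rightarrow> instr" where
  "op_instr Plus = Add"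
| "op_instr Minus = Sub"
| "op_instr Times = Mul"
| "op_instr Divide = Div"

datatype aexp = Num nat | Var nat | Bin aop aexp aexp

fun eval :: "aexp \<Rightarrow> (nat \<Rightarrow> nat) \<Rightarrow> nat" where
  "eval (Num c) \<sigma> = c"
| "eval (Var x) \<sigma> = \<sigma> x"
| "eval (Bin f a b) \<sigma> = apply_op f (eval a \<sigma>) (eval b \<sigma>)"

text \<open>
  Constants and variable numbers count towards the size, so that the size of a program bounds
  all constants, all variables and all register numbers that occur in its compilation.
\<close>

fun esize :: "aexp \<Rightarrow> nat" where
  "esize (Num c) = c + 1"
| "esize (Var x) = x + 1"
| "esize (Bin f a b) = esize a + esize b + 1"

text \<open>Registers from \<open>d\<close> on act as a stack: the result ends up in
  \<open>d\<close>, pending operands lie below the registers still in use. Adding to zero serves as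
  a copy instruction.\<close>

fun compile_exp :: "aexp \<Rightarrow> nat \<Rightarrow> instr list" where
  "compile_exp (Num c) d = [Const d c]"
| "compile_exp (Var x) d = [Const d 0, Add d d x]"
| "compile_exp (Bin f a b) d =
     compile_exp a d @ compile_exp b (d + 1) @ [op_instr f d d (d + 1)]"

text \<open>\<open>For x e c\<close> runs \<open>c\<close> for \<open>x = 0, \<dots>, e - 1\<close>, where \<open>e\<close> is evaluated once, beforehand.\<close>

datatype cmd =
    Assign nat aexp
  | Input nat
  | Output aexp
  | Seq cmd cmd (infixr \<open>;;\<close> 60)
  | For nat aexp cmd

fun csize :: "cmd \<Rightarrow> nat" where
  "csize (Assign x e) = x + esize e + 2"
| "csize (Input x) = x + 1"
| "csize (Output e) = esize e + 1"
| "csize (c1 ;; c2) = csize c1 + csize c2"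
| "csize (For x e c) = x + esize e + csize c + 2"

text \<open>
  Registers from \<open>d\<close> on are scratch; the remaining number of iterations of a loop is kept in
  register \<open>d\<close>.
\<close>

fun compile :: "cmd \<Rightarrow> nat \<Rightarrow> nat \<Rightarrow> instr list" where
  "compile (Assign x e) pc d = compile_exp e d @ [Const (d + 1) 0, Add x d (d + 1)]"
| "compile (Input x) pc d = [Read x]"
| "compile (Output e) pc d = compile_exp e d @ [Write d]"
| "compile (c1 ;; c2) pc d =
     (let p1 = compile c1 pc d in p1 @ compile c2 (pc + length p1) d)"
| "compile (For x e c) pc d =
     (let h = compile_exp e d; l = pc + length h + 1; b = compile c (l + 1) (d + 1)
      in h @ Const x 0 # JZero d (l + length b + 5) # b @
         [Const (d + 1) 1, Add x x (d + 1), Sub d d (d + 1), Jump l])"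

section \<open>Code fragments inside a program and executions of bounded cost\<close>

definition code_at :: "instr list \<Rightarrow> nat \<Rightarrow> instr list \<Rightarrow> bool" where
  "code_at p pc cs \<longleftrightarrow> (\<exists>xs ys. p = xs @ cs @ ys \<and> length xs = pc)"

lemma code_at_append:
  "code_at p pc (a @ b) \<Longrightarrow> code_at p pc a \<and> code_at p (pc + length a) b"
proof -
  assume "code_at p pc (a @ b)"
  then obtain xs ys where "p = xs @ (a @ b) @ ys" "length xs = pc" unfolding code_at_def by auto
  then have "p = xs @ a @ (b @ ys)" "p = (xs @ a) @ b @ ys" "length (xs @ a) = pc + length a"
    by auto
  with \<open>length xs = pc\<close> show ?thesis unfolding code_at_def by blast
qed

lemma code_at_Cons:
  "code_at p pc (i # b) \<Longrightarrow> pc < length p \<and> p ! pc = i \<and> code_at p (Suc pc) b"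
proof -
  assume c: "code_at p pc (i # b)"
  then obtain xs ys where "p = xs @ (i # b) @ ys" "length xs = pc" unfolding code_at_def by blast
  then have "pc < length p \<and> p ! pc = i" by auto
  then show ?thesis using code_at_append[of p pc "[i]" b] c by simp
qed

text \<open>Cost is measured as \<open>n\<close> units of size \<open>B\<close>, so that
  \<open>runs_mono\<close> can pass from single instructions to whole commands as units.\<close>

definition runs :: "instr list \<Rightarrow> nat \<Rightarrow> nat \<Rightarrow> ram_conf \<Rightarrow> ram_conf \<Rightarrow> bool" where
  "runs p B n c c' \<longleftrightarrow> (\<exists>t. ram_exec p c t c' \<and> t \<le> n * B)"

lemma ram_exec_trans:
  "ram_exec p c t c' \<Longrightarrow> ram_exec p c' t' c'' \<Longrightarrow> ram_exec p c (t + t') c''"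
proof (induction rule: ram_exec.induct)
  case (step c t c')
  then show ?case using ram_exec.step[of c p "t + t'" c''] by (simp add: add.assoc)
qed simp

lemma runs_trans: "runs p B n c c' \<Longrightarrow> runs p B n' c' c'' \<Longrightarrow> runs p B (n + n') c c''"
  unfolding runs_def using ram_exec_trans[of p c _ c' _ c'']
  by (auto simp: add_mult_distrib intro: add_le_mono)

lemma runs_mono: "runs p B n c c' \<Longrightarrow> n * B \<le> n' * B' \<Longrightarrow> runs p B' n' c c'"
  unfolding runs_def by (auto intro: le_trans)

lemma runs_refl: "runs p B 0 c c"
  unfolding runs_def using ram_exec.refl by auto

lemma runs_step:
  assumes "pc < length p \<and> p ! pc = i" "instr_cost i (pc, r, inp, out) \<le> B"
  shows "runs p B 1 (pc, r, inp, out) (ram_instr i (pc, r, inp, out))"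
proof -
  have "ram_exec p (pc, r, inp, out) (instr_cost i (pc, r, inp, out) + 0)
          (ram_instr i (pc, r, inp, out))"
    using ram_exec.step[of "(pc, r, inp, out)" p 0] ram_exec.refl assms by fastforce
  then show ?thesis using assms unfolding runs_def by auto
qed

lemma len_mono: "a \<le> b \<Longrightarrow> len a \<le> len b"
  unfolding len_def using floorlog_mono[of a b 2] by auto

lemma len_pos: "1 \<le> len a"
  by (simp add: len_def)

text \<open>A product adds the exponents of its factors; for a sum, the extra 1 in the size of a
  compound expression pays for a factor \<open>2 \<le> X\<close>.\<close>

lemma eval_le:
  assumes "\<forall>y<Z. \<sigma> y \<le> X" "esize e \<le> Z" "2 * Z + 2 \<le> X"
  shows "eval e \<sigma> \<le> X ^ esize e"
  using assms(2)
proof (induction e)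
  case (Num c)
  then have "c \<le> X" using assms by simp
  also have "X \<le> X ^ (c + 1)" using assms by (intro self_le_power) auto
  finally show ?case by simp
next
  case (Var x)
  then have "\<sigma> x \<le> X" using assms by simp
  also have "X \<le> X ^ (x + 1)" using assms by (intro self_le_power) auto
  finally show ?case by simp
next
  case (Bin f a b)
  have X: "X \<ge> 2" using assms by simp
  have IH: "eval a \<sigma> \<le> X ^ esize a" "eval b \<sigma> \<le> X ^ esize b" using Bin by auto
  have m: "X ^ esize a \<le> X ^ (esize a + esize b)" "X ^ esize b \<le> X ^ (esize a + esize b)"
    "X ^ (esize a + esize b) \<le> X ^ (esize a + esize b + 1)"
    using X by (auto intro!: power_increasing simp del: power_Suc)
  show ?case
  proof (cases f)
    case Plus
    have "eval a \<sigma> + eval b \<sigma> \<le> 2 * X ^ (esize a + esize b)" using IH m by linarith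
    also have "\<dots> \<le> X * X ^ (esize a + esize b)" using X by simp
    finally show ?thesis using Plus by simp
  next
    case Minus
    have "eval a \<sigma> - eval b \<sigma> \<le> X ^ (esize a + esize b + 1)" using IH m by linarith
    then show ?thesis using Minus by simp
  next
    case Times
    have "eval a \<sigma> * eval b \<sigma> \<le> X ^ (esize a + esize b)"
      unfolding power_add using IH by (intro mult_mono) auto
    then have "eval a \<sigma> * eval b \<sigma> \<le> X ^ (esize a + esize b + 1)" using m by linarith
    then show ?thesis using Times by simp
  next
    case Divide
    have "eval a \<sigma> div eval b \<sigma> \<le> eval a \<sigma>" by simp
    then have "eval a \<sigma> div eval b \<sigma> \<le> X ^ (esize a + esize b + 1)" using IH m by linarith
    then show ?thesis using Divide by simp
  qed
qed

lemma length_compile_exp: "length (compile_exp e d) \<le> 2 * esize e"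
proof (induction e arbitrary: d)
  case (Bin f a b)
  show ?case using Bin(1)[of d] Bin(2)[of "d + 1"] by simp
qed auto

lemma op_instr_cost:
  "instr_cost (op_instr f i j k) (pc, r, inp, out) = len i + len j + len k + len (r j) + len (r k)"
  "ram_instr (op_instr f i j k) (pc, r, inp, out) =
     (pc + 1, r(i := apply_op f (r j) (r k)), inp, out)"
  by (cases f; simp)+

text \<open>All addresses stay below \<open>X\<close> and all values below \<open>X ^ Z\<close>, so
  each of the five terms in the cost of an arithmetic instruction is at most
  \<open>len (X ^ Z)\<close>. That registers below \<open>d\<close> are preserved keeps the left
  operand alive while the right one is computed.\<close>

lemma compile_exp_correct:
  assumes "\<forall>y<Z. \<sigma> y \<le> X" "2 * Z + 2 \<le> X" "esize e \<le> Z" "Z \<le> d" "d + esize e \<le> 2 * Z"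
    "\<forall>y<Z. r y = \<sigma> y" "code_at p pc (compile_exp e d)"
  shows "\<exists>r'. runs p (5 * len (X ^ Z)) (length (compile_exp e d)) (pc, r, inp, out)
                (pc + length (compile_exp e d), r', inp, out) \<and>
              r' d = eval e \<sigma> \<and> (\<forall>y<d. r' y = r y)"
  using assms(3-)
proof (induction e arbitrary: pc r d)
  case (Num c)
  have "X \<le> X ^ Z" using assms Num by (intro self_le_power) auto
  then have "len d \<le> len (X ^ Z)" "len c \<le> len (X ^ Z)"
    using Num assms by (auto intro!: len_mono)
  then have "runs p (5 * len (X ^ Z)) 1 (pc, r, inp, out) (ram_instr (Const d c) (pc, r, inp, out))"
    using Num code_at_Cons by (intro runs_step) auto
  then have "runs p (5 * len (X ^ Z)) (length (compile_exp (Num c) d)) (pc, r, inp, out)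
      (pc + length (compile_exp (Num c) d), r(d := c), inp, out)" by simp
  moreover have "(r(d := c)) d = eval (Num c) \<sigma> \<and> (\<forall>y<d. (r(d := c)) y = r y)" by simp
  ultimately show ?case by blast
next
  case (Var x)
  have X: "X \<le> X ^ Z" using assms Var by (intro self_le_power) auto
  then have l: "len d \<le> len (X ^ Z)" "len x \<le> len (X ^ Z)" "len (r x) \<le> len (X ^ Z)"
      "len 0 \<le> len (X ^ Z)"
    using Var assms(1,2) X le_trans[OF _ X, of "\<sigma> x"] by (auto intro!: len_mono)
  have c: "pc < length p \<and> p ! pc = Const d 0"
    "Suc pc < length p \<and> p ! Suc pc = Add d d x" using Var by (auto dest!: code_at_Cons)
  have xd: "x \<noteq> d" using Var by simp
  have "runs p (5 * len (X ^ Z)) 1 (pc, r, inp, out) (ram_instr (Const d 0) (pc, r, inp, out))"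
    using l by (intro runs_step[OF c(1)]) auto
  then have r1: "runs p (5 * len (X ^ Z)) 1 (pc, r, inp, out) (Suc pc, r(d := 0), inp, out)" by simp
  have "runs p (5 * len (X ^ Z)) 1 (Suc pc, r(d := 0), inp, out)
         (ram_instr (Add d d x) (Suc pc, r(d := 0), inp, out))"
    using l xd by (intro runs_step[OF c(2)]) auto
  then have "runs p (5 * len (X ^ Z)) (length (compile_exp (Var x) d)) (pc, r, inp, out)
      (pc + length (compile_exp (Var x) d), r(d := r x), inp, out)"
    using runs_trans[OF r1, of 1] xd by (simp add: numeral_2_eq_2)
  moreover have "(r(d := r x)) d = eval (Var x) \<sigma> \<and> (\<forall>y<d. (r(d := r x)) y = r y)"
    using Var by simp
  ultimately show ?case by blast
next
  case (Bin f a b)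
  let ?B = "5 * len (X ^ Z)"
  let ?la = "length (compile_exp a d)" and ?lb = "length (compile_exp b (d + 1))"
  have ca: "code_at p pc (compile_exp a d)"
    and cb: "code_at p (pc + ?la) (compile_exp b (d + 1))"
    and co: "code_at p (pc + ?la + ?lb) [op_instr f d d (d + 1)]"
    using Bin.prems(5) code_at_append[of p pc "compile_exp a d"]
      code_at_append[of p "pc + ?la" "compile_exp b (d + 1)"] by auto
  obtain r1 where r1: "runs p ?B ?la (pc, r, inp, out) (pc + ?la, r1, inp, out)"
      "r1 d = eval a \<sigma>" "\<forall>y<d. r1 y = r y"
    using Bin.IH(1)[OF _ _ _ Bin.prems(4) ca] Bin.prems(1-3) by auto
  have ag: "\<forall>y<Z. r1 y = \<sigma> y" using r1(3) Bin.prems(2,4) by auto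
  obtain r2 where r2: "runs p ?B ?lb (pc + ?la, r1, inp, out) (pc + ?la + ?lb, r2, inp, out)"
      "r2 (d + 1) = eval b \<sigma>" "\<forall>y<d + 1. r2 y = r1 y"
    using Bin.IH(2)[OF _ _ _ ag cb] Bin.prems(1-3) by (auto simp: add.assoc)
  have X: "X \<le> X ^ Z" using assms Bin.prems by (intro self_le_power) auto
  have pw: "eval g \<sigma> \<le> X ^ Z" if "esize g \<le> Z" for g
  proof -
    have "eval g \<sigma> \<le> X ^ esize g" using eval_le assms that by blast
    also have "\<dots> \<le> X ^ Z" using that assms by (intro power_increasing) auto
    finally show ?thesis .
  qed
  have l: "len d \<le> len (X ^ Z)" "len (d + 1) \<le> len (X ^ Z)" "len (r2 d) \<le> len (X ^ Z)"
      "len (r2 (d + 1)) \<le> len (X ^ Z)"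
    using Bin.prems assms X r2 r1 pw[of a] pw[of b] by (auto intro!: len_mono)
  have "runs p ?B 1 (pc + ?la + ?lb, r2, inp, out)
         (ram_instr (op_instr f d d (d + 1)) (pc + ?la + ?lb, r2, inp, out))"
    using l co code_at_Cons by (intro runs_step) (auto simp: op_instr_cost)
  from runs_trans[OF runs_trans[OF r1(1) r2(1)] this]
  have "runs p ?B (length (compile_exp (Bin f a b) d)) (pc, r, inp, out)
      (pc + length (compile_exp (Bin f a b) d), r2(d := eval (Bin f a b) \<sigma>), inp, out)"
    using r1(2) r2(2,3) by (simp add: op_instr_cost add.assoc)
  moreover have "(r2(d := eval (Bin f a b) \<sigma>)) d = eval (Bin f a b) \<sigma> \<and>
      (\<forall>y<d. (r2(d := eval (Bin f a b) \<sigma>)) y = r y)"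
    using r1(3) r2(3) by simp
  ultimately show ?case by blast
qed

text \<open>An instruction has at most five cost terms. An expression of size at most
  \<open>Z\<close> compiles to at most \<open>2 * Z\<close> instructions, and 6 covers the control
  code: two instructions after the expression of an assignment, two for entering and leaving a loop,
  five per iteration.\<close>

definition unit_cost :: "nat \<Rightarrow> nat \<Rightarrow> nat" where
  "unit_cost Z X = (2 * Z + 6) * (5 * len (X ^ Z))"

section \<open>Hoare triples with cost bounds\<close>

type_synonym assertion = "(nat \<Rightarrow> nat) \<Rightarrow> nat list \<Rightarrow> nat list \<Rightarrow> bool"

text \<open>Assertions see the store \<open>\<sigma>\<close>, the machine has the registers
  \<open>r\<close>. Tying them only below \<open>Z\<close> hides the scratch registers, and the
  bound by \<open>X\<close> travels with the store instead of cluttering every assertion.\<close>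

definition agree :: "nat \<Rightarrow> nat \<Rightarrow> (nat \<Rightarrow> nat) \<Rightarrow> (nat \<Rightarrow> nat) \<Rightarrow> bool" where
  "agree Z X \<sigma> r \<longleftrightarrow> (\<forall>y<Z. r y = \<sigma> y \<and> \<sigma> y \<le> X)"

text \<open>
  \<open>k\<close> bounds the number of basic commands and loop iterations, and \<open>X\<close> all values of variables;
  intermediate values of expressions are then at most \<open>X ^ Z\<close>, hence the unit cost.
\<close>

definition hoare :: "nat \<Rightarrow> nat \<Rightarrow> assertion \<Rightarrow> cmd \<Rightarrow> nat \<Rightarrow> assertion \<Rightarrow> bool" where
  "hoare Z X P c k Q \<longleftrightarrow> (\<forall>p pc d \<sigma> r inp out.
     2 * Z + 2 \<le> X \<longrightarrow> csize c \<le> Z \<longrightarrow> Z \<le> d \<longrightarrow> d + csize c \<le> 2 * Z \<longrightarrow>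
     code_at p pc (compile c pc d) \<longrightarrow> agree Z X \<sigma> r \<longrightarrow> P \<sigma> inp out \<longrightarrow>
     (\<exists>\<sigma>' r' inp' out'.
        runs p (unit_cost Z X) k (pc, r, inp, out)
          (pc + length (compile c pc d), r', inp', out') \<and>
        agree Z X \<sigma>' r' \<and> (\<forall>y. Z \<le> y \<longrightarrow> y < d \<longrightarrow> r' y = r y) \<and> Q \<sigma>' inp' out'))"

lemma hoare_Seq:
  assumes "hoare Z X P c1 k1 Q" "hoare Z X Q c2 k2 R"
  shows "hoare Z X P (c1 ;; c2) (k1 + k2) R"
  unfolding hoare_def
proof (intro allI impI)
  fix p pc d \<sigma> r inp out
  assume a: "2 * Z + 2 \<le> X" "csize (c1 ;; c2) \<le> Z" "Z \<le> d" "d + csize (c1 ;; c2) \<le> 2 * Z"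
    "code_at p pc (compile (c1 ;; c2) pc d)" "agree Z X \<sigma> r" "P \<sigma> inp out"
  let ?p1 = "compile c1 pc d"
  let ?p2 = "compile c2 (pc + length ?p1) d"
  have c: "code_at p pc ?p1" "code_at p (pc + length ?p1) ?p2"
    using a code_at_append by (auto simp: Let_def)
  obtain \<sigma>1 r1 i1 o1 where 1: "runs p (unit_cost Z X) k1 (pc, r, inp, out) (pc + length ?p1, r1, i1, o1)"
    "agree Z X \<sigma>1 r1" "\<forall>y. Z \<le> y \<longrightarrow> y < d \<longrightarrow> r1 y = r y" "Q \<sigma>1 i1 o1"
    using assms(1)[unfolded hoare_def, rule_format, OF _ _ _ _ c(1) a(6) a(7)] a by auto
  obtain \<sigma>2 r2 i2 o2 where 2: "runs p (unit_cost Z X) k2 (pc + length ?p1, r1, i1, o1)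
      (pc + length ?p1 + length ?p2, r2, i2, o2)"
    "agree Z X \<sigma>2 r2" "\<forall>y. Z \<le> y \<longrightarrow> y < d \<longrightarrow> r2 y = r1 y" "R \<sigma>2 i2 o2"
    using assms(2)[unfolded hoare_def, rule_format, OF _ _ _ _ c(2) 1(2) 1(4)] a by auto
  have "runs p (unit_cost Z X) (k1 + k2) (pc, r, inp, out)
          (pc + length (compile (c1 ;; c2) pc d), r2, i2, o2)"
    using runs_trans[OF 1(1) 2(1)] by (simp add: Let_def add.assoc)
  then show "\<exists>\<sigma>' r' inp' out'.
        runs p (unit_cost Z X) (k1 + k2) (pc, r, inp, out)
          (pc + length (compile (c1 ;; c2) pc d), r', inp', out') \<and>
        agree Z X \<sigma>' r' \<and> (\<forall>y. Z \<le> y \<longrightarrow> y < d \<longrightarrow> r' y = r y) \<and> R \<sigma>' inp' out'"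
    using 1 2 by (intro exI[of _ \<sigma>2] exI[of _ r2] exI[of _ i2] exI[of _ o2]) simp
qed

lemma hoare_weaken:
  assumes "hoare Z X P c k Q" "\<And>\<sigma> i out. P' \<sigma> i out \<Longrightarrow> P \<sigma> i out"
    "\<And>\<sigma> i out. Q \<sigma> i out \<Longrightarrow> Q' \<sigma> i out" "k \<le> k'"
  shows "hoare Z X P' c k' Q'"
  unfolding hoare_def
proof (intro allI impI)
  fix p pc d \<sigma> r inp out
  assume a: "2 * Z + 2 \<le> X" "csize c \<le> Z" "Z \<le> d" "d + csize c \<le> 2 * Z"
    "code_at p pc (compile c pc d)" "agree Z X \<sigma> r" "P' \<sigma> inp out"
  obtain \<sigma>1 r1 i1 o1 where 1: "runs p (unit_cost Z X) k (pc, r, inp, out)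
      (pc + length (compile c pc d), r1, i1, o1)"
    "agree Z X \<sigma>1 r1" "\<forall>y. Z \<le> y \<longrightarrow> y < d \<longrightarrow> r1 y = r y" "Q \<sigma>1 i1 o1"
    using assms(1)[unfolded hoare_def, rule_format, OF a(1-6) assms(2)[OF a(7)]] by auto
  have "runs p (unit_cost Z X) k' (pc, r, inp, out) (pc + length (compile c pc d), r1, i1, o1)"
    using runs_mono[OF 1(1)] assms(4) by simp
  then show "\<exists>\<sigma>' r' inp' out'.
        runs p (unit_cost Z X) k' (pc, r, inp, out)
          (pc + length (compile c pc d), r', inp', out') \<and>
        agree Z X \<sigma>' r' \<and> (\<forall>y. Z \<le> y \<longrightarrow> y < d \<longrightarrow> r' y = r y) \<and> Q' \<sigma>' inp' out'"
    using 1 assms(3) by blast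
qed

lemma hoare_Assign:
  assumes "\<And>\<sigma> i out. P \<sigma> i out \<Longrightarrow> eval e \<sigma> \<le> X \<and> Q (\<sigma>(x := eval e \<sigma>)) i out"
  shows "hoare Z X P (Assign x e) 1 Q"
  unfolding hoare_def
proof (intro allI impI)
  fix p pc d \<sigma> r inp out
  assume a: "2 * Z + 2 \<le> X" "csize (Assign x e) \<le> Z" "Z \<le> d" "d + csize (Assign x e) \<le> 2 * Z"
    "code_at p pc (compile (Assign x e) pc d)" "agree Z X \<sigma> r" "P \<sigma> inp out"
  let ?B = "5 * len (X ^ Z)" and ?l = "length (compile_exp e d)"
  have c: "code_at p pc (compile_exp e d)" "code_at p (pc + ?l) [Const (d + 1) 0, Add x d (d + 1)]"
    using a(5) code_at_append by auto
  obtain r1 where r1: "runs p ?B ?l (pc, r, inp, out) (pc + ?l, r1, inp, out)"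
     "r1 d = eval e \<sigma>" "\<forall>y<d. r1 y = r y"
    using compile_exp_correct[of Z \<sigma> X e d r p pc inp out] c(1) a unfolding agree_def by auto
  have X: "X \<le> X ^ Z" using a by (intro self_le_power) auto
  have l: "len (d + 1) \<le> len (X ^ Z)" "len d \<le> len (X ^ Z)" "len x \<le> len (X ^ Z)"
      "len 0 \<le> len (X ^ Z)" "len (eval e \<sigma>) \<le> len (X ^ Z)"
    using a X assms[OF a(7)] by (auto intro!: len_mono)
  have s1: "runs p ?B 1 (pc + ?l, r1, inp, out) (ram_instr (Const (d + 1) 0) (pc + ?l, r1, inp, out))"
    using l c(2) code_at_Cons by (intro runs_step) auto
  let ?r2 = "r1(d + 1 := 0)"
  have "runs p ?B 1 (Suc (pc + ?l), ?r2, inp, out)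
      (ram_instr (Add x d (d + 1)) (Suc (pc + ?l), ?r2, inp, out))"
    using l r1 code_at_Cons[OF conjunct2[OF conjunct2[OF code_at_Cons[OF c(2)]]]]
    by (intro runs_step) auto
  then have "runs p ?B 1 (ram_instr (Const (d + 1) 0) (pc + ?l, r1, inp, out))
      (pc + ?l + 2, ?r2(x := eval e \<sigma>), inp, out)"
    using r1(2) by simp
  from runs_trans[OF runs_trans[OF r1(1) s1] this]
  have "runs p ?B (?l + 1 + 1) (pc, r, inp, out) (pc + ?l + 2, ?r2(x := eval e \<sigma>), inp, out)" .
  moreover have "(?l + 1 + 1) * ?B \<le> 1 * unit_cost Z X"
    unfolding unit_cost_def mult_1
    by (rule mult_le_mono1) (use length_compile_exp[of e d] a in simp)
  ultimately have "runs p (unit_cost Z X) 1 (pc, r, inp, out)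
     (pc + length (compile (Assign x e) pc d), ?r2(x := eval e \<sigma>), inp, out)"
    using runs_mono by (fastforce simp: add.assoc)
  moreover have "agree Z X (\<sigma>(x := eval e \<sigma>)) (?r2(x := eval e \<sigma>))"
    using a r1(3) assms[OF a(7)] unfolding agree_def by auto
  moreover have "\<forall>y. Z \<le> y \<longrightarrow> y < d \<longrightarrow> (?r2(x := eval e \<sigma>)) y = r y"
    using r1(3) a by auto
  ultimately show "\<exists>\<sigma>' r' inp' out'.
        runs p (unit_cost Z X) 1 (pc, r, inp, out)
          (pc + length (compile (Assign x e) pc d), r', inp', out') \<and>
        agree Z X \<sigma>' r' \<and> (\<forall>y. Z \<le> y \<longrightarrow> y < d \<longrightarrow> r' y = r y) \<and> Q \<sigma>' inp' out'"
    using conjunct2[OF assms[OF a(7)]] by (intro exI conjI)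
qed

text \<open>A printed value is not stored in a variable, so the bound \<open>X ^ Z\<close> of
  \<open>eval_le\<close> suffices, whereas an assignment has to re-establish the bound
  \<open>X\<close>.\<close>

lemma hoare_Output:
  assumes "\<And>\<sigma> i out. P \<sigma> i out \<Longrightarrow> Q \<sigma> i (out @ [eval e \<sigma>])"
  shows "hoare Z X P (Output e) 1 Q"
  unfolding hoare_def
proof (intro allI impI)
  fix p pc d \<sigma> r inp out
  assume a: "2 * Z + 2 \<le> X" "csize (Output e) \<le> Z" "Z \<le> d" "d + csize (Output e) \<le> 2 * Z"
    "code_at p pc (compile (Output e) pc d)" "agree Z X \<sigma> r" "P \<sigma> inp out"
  let ?B = "5 * len (X ^ Z)" and ?l = "length (compile_exp e d)"
  have c: "code_at p pc (compile_exp e d)" "code_at p (pc + ?l) [Write d]"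
    using a(5) code_at_append by auto
  obtain r1 where r1: "runs p ?B ?l (pc, r, inp, out) (pc + ?l, r1, inp, out)"
     "r1 d = eval e \<sigma>" "\<forall>y<d. r1 y = r y"
    using compile_exp_correct[of Z \<sigma> X e d r p pc inp out] c(1) a unfolding agree_def by auto
  have X: "X \<le> X ^ Z" using a by (intro self_le_power) auto
  have "eval e \<sigma> \<le> X ^ esize e" using eval_le[of Z \<sigma> X e] a unfolding agree_def by auto
  also have "\<dots> \<le> X ^ Z" using a by (intro power_increasing) auto
  finally have l: "len d \<le> len (X ^ Z)" "len (eval e \<sigma>) \<le> len (X ^ Z)"
    using a X by (auto intro!: len_mono)
  have "runs p ?B 1 (pc + ?l, r1, inp, out) (ram_instr (Write d) (pc + ?l, r1, inp, out))"
    using l c(2) code_at_Cons r1(2) by (intro runs_step) auto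
  from runs_trans[OF r1(1) this]
  have "runs p ?B (?l + 1) (pc, r, inp, out) (pc + ?l + 1, r1, inp, out @ [eval e \<sigma>])"
    using r1(2) by simp
  moreover have "(?l + 1) * ?B \<le> 1 * unit_cost Z X"
    unfolding unit_cost_def mult_1
    by (rule mult_le_mono1) (use length_compile_exp[of e d] a in simp)
  ultimately have "runs p (unit_cost Z X) 1 (pc, r, inp, out)
     (pc + length (compile (Output e) pc d), r1, inp, out @ [eval e \<sigma>])"
    using runs_mono by (fastforce simp: add.assoc)
  moreover have "agree Z X \<sigma> r1"
    using a r1(3) unfolding agree_def by auto
  moreover have "\<forall>y. Z \<le> y \<longrightarrow> y < d \<longrightarrow> r1 y = r y"
    using r1(3) a by auto
  ultimately show "\<exists>\<sigma>' r' inp' out'.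
        runs p (unit_cost Z X) 1 (pc, r, inp, out)
          (pc + length (compile (Output e) pc d), r', inp', out') \<and>
        agree Z X \<sigma>' r' \<and> (\<forall>y. Z \<le> y \<longrightarrow> y < d \<longrightarrow> r' y = r y) \<and> Q \<sigma>' inp' out'"
    using assms[OF a(7)] by (intro exI conjI)
qed

lemma hoare_Input:
  assumes "\<And>\<sigma> i out. P \<sigma> i out \<Longrightarrow> \<exists>v i'. i = v # i' \<and> v \<le> X \<and> Q (\<sigma>(x := v)) i' out"
  shows "hoare Z X P (Input x) 1 Q"
  unfolding hoare_def
proof (intro allI impI)
  fix p pc d \<sigma> r inp out
  assume a: "2 * Z + 2 \<le> X" "csize (Input x) \<le> Z" "Z \<le> d" "d + csize (Input x) \<le> 2 * Z"
    "code_at p pc (compile (Input x) pc d)" "agree Z X \<sigma> r" "P \<sigma> inp out"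
  obtain v i' where v: "inp = v # i'" "v \<le> X" "Q (\<sigma>(x := v)) i' out" using assms[OF a(7)] by auto
  have X: "X \<le> X ^ Z" using a by (intro self_le_power) auto
  have l: "len x \<le> len (X ^ Z)" "len v \<le> len (X ^ Z)"
    using a X v by (auto intro!: len_mono)
  have "2 * len (X ^ Z) \<le> unit_cost Z X" unfolding unit_cost_def by simp
  then have "runs p (unit_cost Z X) 1 (pc, r, inp, out) (ram_instr (Read x) (pc, r, inp, out))"
    using l v a(5) code_at_Cons by (intro runs_step) auto
  then have "runs p (unit_cost Z X) 1 (pc, r, inp, out)
     (pc + length (compile (Input x) pc d), r(x := v), i', out)" using v by simp
  moreover have "agree Z X (\<sigma>(x := v)) (r(x := v))"
    using a v unfolding agree_def by auto
  moreover have "\<forall>y. Z \<le> y \<longrightarrow> y < d \<longrightarrow> (r(x := v)) y = r y"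
    using a by auto
  ultimately show "\<exists>\<sigma>' r' inp' out'.
        runs p (unit_cost Z X) 1 (pc, r, inp, out)
          (pc + length (compile (Input x) pc d), r', inp', out') \<and>
        agree Z X \<sigma>' r' \<and> (\<forall>y. Z \<le> y \<longrightarrow> y < d \<longrightarrow> r' y = r y) \<and> Q \<sigma>' inp' out'"
    using v(3) by (intro exI conjI)
qed

text \<open>The loop code increments \<open>x\<close> after the body, so the body leaves
  \<open>x = j\<close> and establishes the next invariant for the store with \<open>x\<close>
  already increased. One unit per iteration pays for the control code, the final one for the bound
  expression, the initialisation and the exit test.\<close>

lemma hoare_For:
  assumes init: "\<And>\<sigma> i out. P \<sigma> i out \<Longrightarrow> eval e \<sigma> = m \<and> I 0 (\<sigma>(x := 0)) i out"
    and body: "\<And>j. j < m \<Longrightarrow> hoare Z X (\<lambda>\<sigma> i out. I j \<sigma> i out \<and> \<sigma> x = j) c k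
        (\<lambda>\<sigma> i out. \<sigma> x = j \<and> I (Suc j) (\<sigma>(x := Suc j)) i out)"
    and m: "m \<le> X"
  shows "hoare Z X P (For x e c) (m * (k + 1) + 1) (I m)"
  unfolding hoare_def
proof (intro allI impI)
  fix p pc d \<sigma> r inp out
  assume a: "2 * Z + 2 \<le> X" "csize (For x e c) \<le> Z" "Z \<le> d" "d + csize (For x e c) \<le> 2 * Z"
    "code_at p pc (compile (For x e c) pc d)" "agree Z X \<sigma> r" "P \<sigma> inp out"
  let ?B = "5 * len (X ^ Z)" and ?h = "length (compile_exp e d)" and ?U = "unit_cost Z X"
  let ?l = "pc + ?h + 1"
  let ?b = "compile c (?l + 1) (d + 1)"
  let ?n = "?l + 1 + length ?b"
  let ?tail = "[Const (d + 1) 1, Add x x (d + 1), Sub d d (d + 1), Jump ?l]"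
  have c0: "code_at p pc (compile_exp e d)"
    and c1: "code_at p (pc + ?h) (Const x 0 # JZero d (?l + length ?b + 5) # ?b @ ?tail)"
    using a(5) code_at_append[of p pc "compile_exp e d"] by (auto simp: Let_def)
  have c2: "pc + ?h < length p \<and> p ! (pc + ?h) = Const x 0"
    and c3: "code_at p ?l (JZero d (?l + length ?b + 5) # ?b @ ?tail)"
    using code_at_Cons[OF c1] by auto
  have c4: "?l < length p \<and> p ! ?l = JZero d (?l + length ?b + 5)"
    and c5: "code_at p (?l + 1) (?b @ ?tail)"
    using code_at_Cons[OF c3] by auto
  have c6: "code_at p (?l + 1) ?b" and c7: "code_at p ?n ?tail"
    using code_at_append[OF c5] by auto
  have c8: "?n < length p \<and> p ! ?n = Const (d + 1) 1"
     "Suc ?n < length p \<and> p ! Suc ?n = Add x x (d + 1)"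
     "Suc (Suc ?n) < length p \<and> p ! Suc (Suc ?n) = Sub d d (d + 1)"
     "Suc (Suc (Suc ?n)) < length p \<and> p ! Suc (Suc (Suc ?n)) = Jump ?l"
    using c7 by (auto dest!: code_at_Cons)
  have X: "X \<le> X ^ Z" using a by (intro self_le_power) auto
  have lX: "len v \<le> len (X ^ Z)" if "v \<le> X" for v using that X by (intro len_mono) simp
  have Bpos: "len (X ^ Z) \<ge> 1" by (rule len_pos)
  have ds: "d + 1 \<le> X" "x \<le> X" "x < Z" using a by auto
  \<comment> \<open>Induction on the number \<open>q\<close> of remaining iterations, which is the
    content of register \<open>d\<close>.\<close>
  have loop: "\<exists>\<sigma>' r' inp' out'. runs p ?U (q * (k + 1)) (?l, r1, i1, o1) (?l, r', inp', out') \<and>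
      r' d = 0 \<and> agree Z X \<sigma>' r' \<and> (\<forall>y. Z \<le> y \<longrightarrow> y < d \<longrightarrow> r' y = r1 y) \<and> I m \<sigma>' inp' out'"
    if "q \<le> m" "r1 d = q" "agree Z X \<sigma>1 r1" "I (m - q) \<sigma>1 i1 o1" "\<sigma>1 x = m - q" for q r1 \<sigma>1 i1 o1
    using that
  proof (induction q arbitrary: r1 \<sigma>1 i1 o1)
    case 0
    then show ?case using runs_refl[of p ?U] by fastforce
  next
    case (Suc q)
    let ?j = "m - Suc q"
    have j: "?j < m" "Suc ?j = m - q" using Suc.prems by auto
    have s1: "runs p ?B 1 (?l, r1, i1, o1) (ram_instr (JZero d (?l + length ?b + 5)) (?l, r1, i1, o1))"
      using Suc.prems ds m lX[of d] lX[of "r1 d"] by (intro runs_step[OF c4]) auto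
    then have s1: "runs p ?B 1 (?l, r1, i1, o1) (?l + 1, r1, i1, o1)" using Suc.prems by simp
    have *: "csize c \<le> Z" "Z \<le> d + 1" "d + 1 + csize c \<le> 2 * Z" using a by auto
    have **: "I ?j \<sigma>1 i1 o1 \<and> \<sigma>1 x = ?j" using Suc.prems by auto
    obtain \<sigma>2 r2 i2 o2 where 2: "runs p ?U k (?l + 1, r1, i1, o1) (?n, r2, i2, o2)"
       "agree Z X \<sigma>2 r2" "\<forall>y. Z \<le> y \<longrightarrow> y < d + 1 \<longrightarrow> r2 y = r1 y"
       "\<sigma>2 x = ?j" "I (Suc ?j) (\<sigma>2(x := Suc ?j)) i2 o2"
      using body[OF j(1), unfolded hoare_def, rule_format, OF a(1) * c6 Suc.prems(3) **] by blast
    have jX: "?j \<le> X" "Suc q \<le> X" using m Suc.prems by auto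
    \<comment> \<open>The body is compiled with scratch space from \<open>d + 1\<close> on, so its
      frame condition protects the counter in \<open>d\<close>.\<close>
    have r2: "r2 d = Suc q" "r2 x = ?j" using 2 Suc.prems a ds unfolding agree_def by auto
    have s2: "runs p ?B 1 (?n, r2, i2, o2) (ram_instr (Const (d + 1) 1) (?n, r2, i2, o2))"
      using lX[OF ds(1)] lX[of 1] a by (intro runs_step[OF c8(1)]) auto
    let ?r3 = "r2(d + 1 := 1)"
    have s3: "runs p ?B 1 (Suc ?n, ?r3, i2, o2) (ram_instr (Add x x (d + 1)) (Suc ?n, ?r3, i2, o2))"
      using lX[OF ds(1)] lX[OF ds(2)] lX[of 1] lX[OF jX(1)] a(1,3) ds r2
      by (intro runs_step[OF c8(2)]) auto
    let ?r4 = "?r3(x := Suc ?j)"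
    have s4: "runs p ?B 1 (Suc (Suc ?n), ?r4, i2, o2)
        (ram_instr (Sub d d (d + 1)) (Suc (Suc ?n), ?r4, i2, o2))"
      using lX[OF ds(1)] lX[of d] lX[of 1] lX[OF jX(2)] a(1,3) ds r2
      by (intro runs_step[OF c8(3)]) auto
    let ?r5 = "?r4(d := q)"
    have s5: "runs p ?B 1 (Suc (Suc (Suc ?n)), ?r5, i2, o2)
        (ram_instr (Jump ?l) (Suc (Suc (Suc ?n)), ?r5, i2, o2))"
      using Bpos by (intro runs_step[OF c8(4)]) auto
    have xd: "x \<noteq> d" "x \<noteq> d + 1" using ds a by auto
    have e2: "ram_instr (Const (d + 1) 1) (?n, r2, i2, o2) = (Suc ?n, ?r3, i2, o2)" by simp
    have e3: "ram_instr (Add x x (d + 1)) (Suc ?n, ?r3, i2, o2) = (Suc (Suc ?n), ?r4, i2, o2)"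
      using r2 xd by simp
    have e4: "ram_instr (Sub d d (d + 1)) (Suc (Suc ?n), ?r4, i2, o2)
        = (Suc (Suc (Suc ?n)), ?r5, i2, o2)"
      using r2 xd by simp
    have e5: "ram_instr (Jump ?l) (Suc (Suc (Suc ?n)), ?r5, i2, o2) = (?l, ?r5, i2, o2)" by simp
    have t4: "runs p ?B (1 + 1 + 1 + 1) (?n, r2, i2, o2) (?l, ?r5, i2, o2)"
      using runs_trans[OF runs_trans[OF runs_trans[OF s2[unfolded e2] s3[unfolded e3]]
        s4[unfolded e4]] s5[unfolded e5]] .
    have "runs p ?U k (?l + 1, r1, i1, o1) (?n, r2, i2, o2)" by (rule 2)
    then obtain t where t: "ram_exec p (?l + 1, r1, i1, o1) t (?n, r2, i2, o2)" "t \<le> k * ?U"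
      unfolding runs_def by auto
    obtain t1 where t1: "ram_exec p (?l, r1, i1, o1) t1 (?l + 1, r1, i1, o1)" "t1 \<le> 1 * ?B"
      using s1 unfolding runs_def by auto
    obtain t2 where t2: "ram_exec p (?n, r2, i2, o2) t2 (?l, ?r5, i2, o2)" "t2 \<le> (1 + 1 + 1 + 1) * ?B"
      using t4 unfolding runs_def by blast
    have "5 * ?B \<le> ?U" unfolding unit_cost_def by (rule mult_le_mono1) simp
    then have "t1 + t + t2 \<le> (k + 1) * ?U" using t t1 t2 by (simp add: algebra_simps)
    then have it: "runs p ?U (k + 1) (?l, r1, i1, o1) (?l, ?r5, i2, o2)"
      unfolding runs_def using ram_exec_trans[OF ram_exec_trans[OF t1(1) t(1)] t2(1)] by blast
    have ag: "agree Z X (\<sigma>2(x := Suc ?j)) ?r5"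
      using 2(2) a m j ds unfolding agree_def by auto
    have inv: "I (m - q) (\<sigma>2(x := Suc ?j)) i2 o2" using 2(5) j by simp
    obtain \<sigma>' r' inp' out' where 6: "runs p ?U (q * (k + 1)) (?l, ?r5, i2, o2) (?l, r', inp', out')"
      "r' d = 0" "agree Z X \<sigma>' r'" "\<forall>y. Z \<le> y \<longrightarrow> y < d \<longrightarrow> r' y = ?r5 y" "I m \<sigma>' inp' out'"
      using Suc.IH[OF _ _ ag inv] Suc_leD[OF Suc.prems(1)] j(2) by fastforce
    have "runs p ?U (Suc q * (k + 1)) (?l, r1, i1, o1) (?l, r', inp', out')"
      using runs_trans[OF it 6(1)] by (simp add: algebra_simps)
    moreover have "\<forall>y. Z \<le> y \<longrightarrow> y < d \<longrightarrow> r' y = r1 y" using 6(4) 2(3) ds by auto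
    ultimately show ?case using 6 by blast
  qed
  obtain r1 where r1: "runs p ?B ?h (pc, r, inp, out) (pc + ?h, r1, inp, out)"
     "r1 d = eval e \<sigma>" "\<forall>y<d. r1 y = r y"
    using compile_exp_correct[of Z \<sigma> X e d r p pc inp out] c0 a unfolding agree_def by auto
  have em: "eval e \<sigma> = m" "I 0 (\<sigma>(x := 0)) inp out" using init[OF a(7)] by auto
  have "runs p ?B 1 (pc + ?h, r1, inp, out) (ram_instr (Const x 0) (pc + ?h, r1, inp, out))"
    using lX[OF ds(2)] lX[of 0] by (intro runs_step[OF c2]) auto
  from runs_trans[OF r1(1) this]
  have h1: "runs p ?B (?h + 1) (pc, r, inp, out) (?l, r1(x := 0), inp, out)" by simp
  have ag: "agree Z X (\<sigma>(x := 0)) (r1(x := 0))" using a(3,6) r1(3) unfolding agree_def by auto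
  have rd: "(r1(x := 0)) d = m" using r1(2) em ds a(3) by auto
  have Im: "I (m - m) (\<sigma>(x := 0)) inp out" using em by simp
  obtain \<sigma>' r' inp' out' where L: "runs p ?U (m * (k + 1)) (?l, r1(x := 0), inp, out) (?l, r', inp', out')"
      "r' d = 0" "agree Z X \<sigma>' r'" "\<forall>y. Z \<le> y \<longrightarrow> y < d \<longrightarrow> r' y = (r1(x := 0)) y" "I m \<sigma>' inp' out'"
    using loop[OF order.refl rd ag Im] by auto
  have "runs p ?B 1 (?l, r', inp', out') (ram_instr (JZero d (?l + length ?b + 5)) (?l, r', inp', out'))"
    using lX[of d] lX[of 0] ds L by (intro runs_step[OF c4]) auto
  then have fin: "runs p ?B 1 (?l, r', inp', out') (?l + length ?b + 5, r', inp', out')"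
    using L by simp
  obtain t1 where t1: "ram_exec p (pc, r, inp, out) t1 (?l, r1(x := 0), inp, out)"
    "t1 \<le> (?h + 1) * ?B" using h1 unfolding runs_def by auto
  obtain t2 where t2: "ram_exec p (?l, r1(x := 0), inp, out) t2 (?l, r', inp', out')"
    "t2 \<le> m * (k + 1) * ?U" using L unfolding runs_def by auto
  obtain t3 where t3: "ram_exec p (?l, r', inp', out') t3 (?l + length ?b + 5, r', inp', out')"
    "t3 \<le> 1 * ?B" using fin unfolding runs_def by auto
  have "(?h + 2) * ?B \<le> ?U" unfolding unit_cost_def
    by (rule mult_le_mono1) (use length_compile_exp[of e d] a in simp)
  then have "t1 + t2 + t3 \<le> (m * (k + 1) + 1) * ?U"
    using t1 t2 t3 by (simp add: algebra_simps)
  then have "runs p ?U (m * (k + 1) + 1) (pc, r, inp, out) (?l + length ?b + 5, r', inp', out')"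
    unfolding runs_def using ram_exec_trans[OF ram_exec_trans[OF t1(1) t2(1)] t3(1)] by blast
  moreover have "?l + length ?b + 5 = pc + length (compile (For x e c) pc d)"
    by (simp add: Let_def)
  ultimately have "runs p ?U (m * (k + 1) + 1) (pc, r, inp, out)
      (pc + length (compile (For x e c) pc d), r', inp', out')"
    by (simp only:)
  moreover have "\<forall>y. Z \<le> y \<longrightarrow> y < d \<longrightarrow> r' y = r y" using L(4) r1(3) ds by auto
  ultimately show "\<exists>\<sigma>' r' inp' out'.
        runs p ?U (m * (k + 1) + 1) (pc, r, inp, out)
          (pc + length (compile (For x e c) pc d), r', inp', out') \<and>
        agree Z X \<sigma>' r' \<and> (\<forall>y. Z \<le> y \<longrightarrow> y < d \<longrightarrow> r' y = r y) \<and> I m \<sigma>' inp' out'"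
    using L(3,5) by blast
qed

text \<open>With scratch space starting at \<open>Z = csize c\<close>, the condition
  \<open>d + csize c \<le> 2 * Z\<close> holds with equality.\<close>

lemma hoare_ram_computes:
  assumes "hoare Z X (\<lambda>\<sigma> i out. i = xs \<and> out = []) c k (\<lambda>\<sigma> i out. out = ys)"
    "Z = csize c" "2 * Z + 2 \<le> X"
  shows "\<exists>t. ram_computes (compile c 0 Z) xs ys t \<and> t \<le> k * unit_cost Z X"
proof -
  have ca: "code_at (compile c 0 Z) 0 (compile c 0 Z)" unfolding code_at_def by auto
  have ag: "agree Z X (\<lambda>_. 0) (\<lambda>_. 0)" unfolding agree_def by simp
  obtain \<sigma>' r' inp' where "runs (compile c 0 Z) (unit_cost Z X) k (0, \<lambda>_. 0, xs, [])
      (0 + length (compile c 0 Z), r', inp', ys)"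
    using assms(1)[unfolded hoare_def, rule_format, OF assms(3) _ _ _ ca ag] assms(2) by auto
  then show ?thesis unfolding runs_def ram_computes_def by force
qed

section \<open>Simulation of bounded-space machines by branching programs\<close>

definition tape_code :: "nat \<Rightarrow> nat \<Rightarrow> (nat \<Rightarrow> nat) \<Rightarrow> nat" where
  "tape_code G S w = (\<Sum>k<S. w k * G ^ k)"

lemma tape_code_less:
  assumes "\<And>k. w k < G"
  shows "tape_code G S w < G ^ S"
proof (induction S)
  case (Suc S)
  have "w S * G ^ S + G ^ S \<le> G * G ^ S"
    using assms[of S] mult_le_mono1[of "Suc (w S)" G "G ^ S"] by simp
  then show ?case using Suc by (simp add: tape_code_def)
qed (simp add: tape_code_def)

text \<open>A new leading term \<open>w S * G ^ S\<close> is either the digit asked for or, after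
  division by \<open>G ^ h\<close>, a multiple of \<open>G\<close> that vanishes modulo
  \<open>G\<close>.\<close>

lemma tape_code_digit:
  assumes w: "\<And>k. w k < G" and h: "h < S"
  shows "tape_code G S w div G ^ h mod G = w h"
  using h
proof (induction S)
  case (Suc S)
  have G: "G > 0" using w[of 0] by simp
  show ?case
  proof (cases "h = S")
    case True
    have "tape_code G (Suc S) w div G ^ S = w S"
      using tape_code_less[OF w, of S] G by (simp add: tape_code_def)
    then show ?thesis using True w by simp
  next
    case False
    then have hS: "h < S" using Suc by simp
    then obtain t where S: "S = h + Suc t" using less_imp_Suc_add by (metis add_Suc_right)
    have "tape_code G (Suc S) w = tape_code G S w + G ^ h * (G * (w S * G ^ t))"
      by (simp add: tape_code_def S power_add)
    then have "tape_code G (Suc S) w div G ^ h = tape_code G S w div G ^ h + G * (w S * G ^ t)"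
      using G by simp
    then show ?thesis using Suc.IH hS by simp
  qed
qed simp

text \<open>The truncated subtraction is exact, because \<open>w h * G ^ h\<close> is one of the
  summands of the old code.\<close>

lemma tape_code_upd:
  assumes "h < S"
  shows "tape_code G S (w(h := g)) = tape_code G S w + g * G ^ h - w h * G ^ h"
proof -
  have "tape_code G S v = v h * G ^ h + (\<Sum>k\<in>{..<S} - {h}. v k * G ^ k)" for v
    unfolding tape_code_def using assms by (subst sum.remove[of _ h]) auto
  from this[of w] this[of "w(h := g)"] show ?thesis by simp
qed

text \<open>The work head position \<open>h\<close> is represented by the power \<open>G ^ h\<close>.\<close>

fun conf_code :: "nat \<Rightarrow> nat \<Rightarrow> nat \<Rightarrow> ntm_conf \<Rightarrow> nat" where
  "conf_code K G S (q, i, h, w) = q + K * (i + K * (G ^ h + K * tape_code G S w))"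

lemma conf_code_decode:
  fixes S :: nat and w :: "nat \<Rightarrow> nat"
  assumes "q < K" "i < K" "G ^ h < K"
  defines "u \<equiv> conf_code K G S (q, i, h, w)"
  shows "u mod K = q" "u div K mod K = i" "u div K div K mod K = G ^ h"
    "u div K div K div K = tape_code G S w"
  unfolding u_def using assms by auto

lemma conf_code_less:
  assumes "q < K" "i < K" "G ^ h < K" "tape_code G S w < K"
  shows "conf_code K G S (q, i, h, w) < K * K * K * K"
proof -
  have *: "a + K * b < K * c" if "a < K" "b < c" for a b c
  proof -
    have "a + K * b < K * Suc b" using that by simp
    also have "\<dots> \<le> K * c" using that by (intro mult_le_mono2) simp
    finally show ?thesis .
  qed
  have "G ^ h + K * tape_code G S w < K * K" using assms by (intro *)
  then have "i + K * (G ^ h + K * tape_code G S w) < K * (K * K)" using assms by (intro *)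
  then have "conf_code K G S (q, i, h, w) < K * (K * (K * K))" using assms by (simp only: conf_code.simps *)
  then show ?thesis by (simp only: mult.assoc)
qed

text \<open>In truncated arithmetic \<open>a - (a - b)\<close> is the minimum of \<open>a\<close>
  and \<open>b\<close>; it confines the head to the right end marker.\<close>

fun head_move :: "nat \<Rightarrow> dir \<Rightarrow> nat \<Rightarrow> nat" where
  "head_move z MoveL i = i - 1"
| "head_move z Stay i = i"
| "head_move z MoveR i = (i + 1) - ((i + 1) - (z - 1))"

text \<open>The sum \<open>a + (1 - a)\<close> is the maximum of \<open>a\<close> and 1; it keeps
  \<open>G ^ 0\<close> when the head is already at the left end.\<close>

fun power_move :: "nat \<Rightarrow> dir \<Rightarrow> nat \<Rightarrow> nat" where
  "power_move G MoveL P = P div G + (1 - P div G)"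
| "power_move G Stay P = P"
| "power_move G MoveR P = P * G"

lemma head_move: "head_move (l + 2) d i = min (move d i) (l + 1)" if "i \<le> l + 1"
  using that by (cases d) auto

lemma power_move: "power_move G d (G ^ h) = G ^ move d h" if "2 \<le> G"
proof (cases d)
  case MoveL
  show ?thesis
  proof (cases h)
    case (Suc h')
    have "1 \<le> G ^ h'" using that by simp
    then show ?thesis using MoveL Suc that by simp
  qed (use MoveL that in simp)
qed auto

fun symbol_edge :: "nat \<Rightarrow> insym \<Rightarrow> nat \<Rightarrow> bool \<Rightarrow> bool" where
  "symbol_edge z LeftEnd j m \<longleftrightarrow> j = 0"
| "symbol_edge z RightEnd j m \<longleftrightarrow> j = z - 1"
| "symbol_edge z (Bit b) j m \<longleftrightarrow> 0 < j \<and> j < z - 1 \<and> m = b"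

fun trans_edge ::
    "nat \<Rightarrow> nat \<Rightarrow> nat \<Rightarrow> nat \<times> insym \<times> nat \<times> nat \<times> nat \<times> dir \<times> dir \<Rightarrow> nat \<Rightarrow> bool \<Rightarrow> nat \<Rightarrow> nat \<Rightarrow> bool"
where
  "trans_edge K G z (q, s, g, q', g', d, d') j m u v \<longleftrightarrow>
     (let i = u div K mod K; P = u div K div K mod K; w = u div K div K div K
      in u mod K = q \<and> i = j \<and> symbol_edge z s j m \<and> w div P mod G = g \<and>
         v = q' + K * (head_move z d i + K * (power_move G d' P + K * (w + g' * P - g * P))))"

text \<open>
  Node 0 is no configuration, as \<open>G ^ h > 0\<close>. It is the source in layer 0 and a sink entered
  by accepting configurations in all later layers.
\<close>

definition sim_edge :: "ntm \<Rightarrow> nat \<Rightarrow> nat \<Rightarrow> nat \<Rightarrow> nat \<Rightarrow> nat \<Rightarrow> nat \<Rightarrow> bool \<Rightarrow> bool" where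
  "sim_edge M K G z i u v m \<longleftrightarrow>
     (if i = 0 then u = 0 \<and> v = ntm_start M + K * K
      else u = v \<or> (v = 0 \<and> u mod K = ntm_accept M) \<or>
           (\<exists>tr\<in>ntm_delta M. trans_edge K G z tr (i mod z) m u v))"

text \<open>The product dominates the bounds of all four digits: \<open>B\<close> for states,
  \<open>2 * n + 2\<close> for input head positions, and \<open>B ^ S\<close> for both
  \<open>B ^ h\<close> and the tape code.\<close>

definition radix :: "nat \<Rightarrow> nat \<Rightarrow> nat \<Rightarrow> nat" where
  "radix B S n = (2 * n + 2 + B) * B ^ S"

definition width :: "nat \<Rightarrow> nat \<Rightarrow> nat \<Rightarrow> nat" where
  "width B S n = radix B S n * radix B S n * radix B S n * radix B S n"

text \<open>Counts the gaps between layers of nodes: one out of the source, one into the sink, and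
  between them \<open>W * W\<close> rounds with a gap for every variable.\<close>

definition layers :: "nat \<Rightarrow> nat \<Rightarrow> nat \<Rightarrow> nat" where
  "layers B S n = 2 + (2 * n + 2) * (width B S n * width B S n)"

definition sim_bp :: "ntm \<Rightarrow> nat \<Rightarrow> nat \<Rightarrow> nat \<Rightarrow> bp" where
  "sim_bp M B S n =
     \<lparr>bp_inputs = 2 * n + 2, bp_length = layers B S n + 1, bp_width = width B S n,
      bp_label = (\<lambda>i. i mod (2 * n + 2)),
      bp_edges = {(i, u, v, m). i < layers B S n \<and> u < width B S n \<and> v < width B S n \<and>
        sim_edge M (radix B S n) B (2 * n + 2) i u v m}\<rparr>"

section \<open>Acceptance as reachability, and correctness of the simulation\<close>

inductive bp_reach :: "bp \<Rightarrow> bool list \<Rightarrow> nat \<Rightarrow> nat \<Rightarrow> bool" for P y where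
  start: "bp_reach P y 0 0"
| step: "bp_reach P y i u \<Longrightarrow> (i, u, v, y ! bp_label P i) \<in> bp_edges P \<Longrightarrow> bp_reach P y (Suc i) v"

lemma bp_reach_path:
  "bp_reach P y i u \<Longrightarrow>
     \<exists>p. p 0 = 0 \<and> p i = u \<and> (\<forall>k<i. (k, p k, p (k + 1), y ! bp_label P k) \<in> bp_edges P)"
proof (induction rule: bp_reach.induct)
  case (step i u v)
  then obtain p where p: "p 0 = 0" "p i = u"
    "\<forall>k<i. (k, p k, p (k + 1), y ! bp_label P k) \<in> bp_edges P" by auto
  have "\<forall>k<Suc i. (k, (p(Suc i := v)) k, (p(Suc i := v)) (k + 1), y ! bp_label P k) \<in> bp_edges P"
    using p step.hyps by (auto simp: less_Suc_eq)
  then show ?case using p by (intro exI[of _ "p(Suc i := v)"]) simp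
qed (auto intro: exI[of _ "\<lambda>_. 0"])

lemma path_bp_reach:
  assumes "p 0 = 0" "\<forall>k<i. (k, p k, p (k + 1), y ! bp_label P k) \<in> bp_edges P"
  shows "bp_reach P y i (p i)"
  using assms(2)
proof (induction i)
  case 0
  then show ?case using assms(1) bp_reach.start by metis
next
  case (Suc i)
  then show ?case using bp_reach.step[of P y i "p i" "p (Suc i)"] by simp
qed

lemma bp_accepts_iff_reach:
  "bp_length P = Suc E \<Longrightarrow> bp_accepts P y \<longleftrightarrow> bp_reach P y E 0"
proof
  assume E: "bp_length P = Suc E" and "bp_accepts P y"
  then obtain p where p: "p 0 = 0" "p E = 0"
    "\<forall>k<E. (k, p k, p (k + 1), y ! bp_label P k) \<in> bp_edges P"
    unfolding bp_accepts_def by auto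
  from path_bp_reach[OF p(1,3)] p(2) show "bp_reach P y E 0" by simp
next
  assume E: "bp_length P = Suc E" and "bp_reach P y E 0"
  from bp_reach_path[OF this(2)] E show "bp_accepts P y" unfolding bp_accepts_def by simp
qed

text \<open>It suffices to bound the targets of transitions: a reachable state is the start state or
  such a target, a symbol on the tape is blank or was written. The same \<open>B\<close> is then the
  radix of the tape code.\<close>

locale bounded_ntm =
  fixes M :: ntm and B S n :: nat and x :: "bool list"
  assumes delta_bound: "(q, s, g, q', g', d, d') \<in> ntm_delta M \<Longrightarrow> q' < B \<and> g' < B"
    and start_bound: "ntm_start M < B"
    and B_ge: "2 \<le> B"
    and space: "ntm_reachable M x (q, i, h, w) \<Longrightarrow> h < S"
    and length_x: "length x = 2 * n"
begin

abbreviation "K \<equiv> radix B S n"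
abbreviation "W \<equiv> width B S n"
abbreviation "z \<equiv> 2 * n + 2"
abbreviation "P \<equiv> sim_bp M B S n"
abbreviation "code \<equiv> conf_code K B S"
abbreviation "y \<equiv> False # x @ [False]"

lemma reachable_bounds:
  assumes "ntm_reachable M x (q, i, h, w)"
  shows "q < B" "i \<le> 2 * n + 1" "h < S" "w k < B"
proof -
  have "(\<lambda>(q, i, h, w). q < B \<and> i \<le> 2 * n + 1 \<and> (\<forall>k. w k < B)) c"
    if "(ntm_step M x)\<^sup>*\<^sup>* (ntm_init M) c" for c
    using that
  proof (induction rule: rtranclp_induct)
    case base
    then show ?case using start_bound B_ge by (simp add: ntm_init_def)
  next
    case (step c c')
    from step(2) step(3) show ?case
      by (cases rule: ntm_step.cases) (use delta_bound length_x in auto)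
  qed
  from this[OF assms[unfolded ntm_reachable_def]] space[OF assms]
  show "q < B" "i \<le> 2 * n + 1" "h < S" "w k < B" by auto
qed

lemma radix_bounds:
  shows "B \<le> K" "z \<le> K" "B ^ S \<le> K"
proof -
  have p: "1 \<le> B ^ S" using B_ge by simp
  then show "B \<le> K" "z \<le> K"
    unfolding radix_def using mult_le_mono2[OF p, of "2 * n + 2 + B"] by auto
  show "B ^ S \<le> K" unfolding radix_def by simp
qed

lemma reachable_code_bounds:
  assumes "ntm_reachable M x (q, i, h, w)"
  shows "q < K" "i < K" "B ^ h < K" "tape_code B S w < K" "code (q, i, h, w) < W"
proof -
  note b = reachable_bounds[OF assms]
  show 1: "q < K" "i < K" using b radix_bounds by auto
  have "B ^ h < B ^ S" using b B_ge by (intro power_strict_increasing) auto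
  then show 2: "B ^ h < K" using radix_bounds by simp
  show 3: "tape_code B S w < K"
    using tape_code_less[of w B S] b radix_bounds by fastforce
  show "code (q, i, h, w) < W" unfolding width_def by (rule conf_code_less[OF 1 2 3])
qed

lemma symbol_edge_iff:
  "i \<le> 2 * n + 1 \<Longrightarrow> symbol_edge z s i (y ! i) \<longleftrightarrow> s = input_at x i"
  by (cases s) (auto simp: input_at_def length_x nth_Cons' nth_append)

text \<open>For a reachable configuration all digits are below \<open>K\<close>, so the arithmetic
  decoding recovers them. The test \<open>w h = g\<close> turns the numerical update into
  \<open>tape_code_upd\<close>.\<close>

lemma trans_edge_sound:
  assumes "ntm_reachable M x c" "tr \<in> ntm_delta M" "trans_edge K B z tr j (y ! j) (code c) v"
  shows "\<exists>c'. ntm_step M x c c' \<and> v = code c'"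
proof -
  obtain q i h w where c: "c = (q, i, h, w)" by (cases c)
  obtain q1 s g q' g' d d' where tr: "tr = (q1, s, g, q', g', d, d')" by (cases tr)
  note r = assms(1)[unfolded c]
  note b = reachable_bounds[OF r] and cb = reachable_code_bounds[OF r]
  note dec = conf_code_decode[OF cb(1-3), of S w]
  have dig: "tape_code B S w div B ^ h mod B = w h" using b by (intro tape_code_digit) auto
  have t: "q = q1" "i = j" "symbol_edge z s j (y ! j)" "w h = g"
    "v = q' + K * (head_move z d i + K * (power_move B d' (B ^ h) +
        K * (tape_code B S w + g' * B ^ h - g * B ^ h)))"
    using assms(3) unfolding tr c trans_edge.simps Let_def dec dig by auto
  have "s = input_at x i" using t b symbol_edge_iff by simp
  then have "ntm_step M x c (q', min (move d i) (length x + 1), move d' h, w(h := g'))"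
    unfolding c using t assms(2) tr by (intro ntm_step.intros) auto
  moreover have "v = code (q', min (move d i) (length x + 1), move d' h, w(h := g'))"
    unfolding t(5) using head_move[of i "2 * n"] power_move[OF B_ge] b t(4)
    by (simp add: length_x tape_code_upd)
  ultimately show ?thesis by blast
qed

lemma trans_edge_complete:
  assumes r: "ntm_reachable M x c" and "ntm_step M x c c'"
  shows "\<exists>tr\<in>ntm_delta M. \<exists>j<z. trans_edge K B z tr j (y ! j) (code c) (code c')"
  using assms(2)
proof (cases rule: ntm_step.cases)
  case (1 q i w h q' g' d d')
  note r = r[unfolded 1(1)]
  note b = reachable_bounds[OF r] and cb = reachable_code_bounds[OF r]
  note dec = conf_code_decode[OF cb(1-3), of S w]
  have dig: "tape_code B S w div B ^ h mod B = w h" using b by (intro tape_code_digit) auto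
  have "symbol_edge z (input_at x i) i (y ! i)" using b symbol_edge_iff by simp
  moreover have "code c' = q' + K * (head_move z d i + K * (power_move B d' (B ^ h) +
        K * (tape_code B S w + g' * B ^ h - w h * B ^ h)))"
    unfolding 1 using head_move[of i "2 * n"] power_move[OF B_ge] b
    by (simp add: length_x tape_code_upd)
  ultimately have "trans_edge K B z (q, input_at x i, w h, q', g', d, d') i (y ! i) (code c) (code c')"
    unfolding 1(1) trans_edge.simps Let_def dec dig by blast
  moreover have "i < z" using b by simp
  ultimately show ?thesis using 1(3) by blast
qed

lemma code_init: "code (ntm_init M) = ntm_start M + K * K"
  by (simp add: ntm_init_def tape_code_def)

lemma code_pos: "0 < code c"
proof -
  obtain q i h w where c: "c = (q, i, h, w)" by (cases c)
  have "0 < K" "0 < B ^ h" using radix_bounds B_ge by auto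
  then show ?thesis by (simp add: c)
qed

lemma reachable_step: "ntm_reachable M x c \<Longrightarrow> ntm_step M x c c' \<Longrightarrow> ntm_reachable M x c'"
  unfolding ntm_reachable_def by simp

text \<open>Acceptance is an alternative in the invariant, because nothing is claimed about edges
  that leave the sink. At the end the other alternative is impossible, as codes are
  positive.\<close>

lemma sim_bp_sound:
  assumes "bp_accepts P y"
  shows "ntm_accepts M x"
proof -
  have inv: "i = 0 \<and> u = 0 \<or> i > 0 \<and> (ntm_accepts M x \<or> (\<exists>c. ntm_reachable M x c \<and> u = code c))"
    if "bp_reach P y i u" for i u
    using that
  proof (induction rule: bp_reach.induct)
    case (step i u v)
    have e: "sim_edge M K B z i u v (y ! (i mod z))" using step(2) by (auto simp: sim_bp_def)
    show ?case
    proof (cases "i = 0")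
      case True
      then have "v = code (ntm_init M)" using e code_init by (simp add: sim_edge_def)
      moreover have "ntm_reachable M x (ntm_init M)" by (simp add: ntm_reachable_def)
      ultimately show ?thesis by blast
    next
      case i: False
      have "ntm_accepts M x \<or> (\<exists>c. ntm_reachable M x c \<and> v = code c)"
      proof (cases "ntm_accepts M x")
        case False
        then obtain c where c: "ntm_reachable M x c" "u = code c" using step.IH i by blast
        obtain q k h w where cq: "c = (q, k, h, w)" by (cases c)
        consider "u = v" | "u mod K = ntm_accept M"
          | tr where "tr \<in> ntm_delta M" "trans_edge K B z tr (i mod z) (y ! (i mod z)) u v"
          using e i by (auto simp: sim_edge_def)
        then show ?thesis
        proof cases
          case 1
          then show ?thesis using c by blast
        next
          case 2
          have "u mod K = q" unfolding c(2) cq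
            by (rule conf_code_decode) (use reachable_code_bounds c cq in auto)
          then have "ntm_accepts M x" unfolding ntm_accepts_def using c cq 2 by auto
          then show ?thesis by simp
        next
          case 3
          then obtain c' where "ntm_step M x c c'" "v = code c'"
            using trans_edge_sound[OF c(1)] c(2) by blast
          then show ?thesis using reachable_step[OF c(1)] by blast
        qed
      qed simp
      then show ?thesis by blast
    qed
  qed simp
  have "bp_reach P y (layers B S n) 0"
    using assms bp_accepts_iff_reach[of P "layers B S n"] by (simp add: sim_bp_def)
  moreover have "layers B S n \<noteq> 0" by (simp add: layers_def)
  ultimately show ?thesis using inv code_pos by (metis less_irrefl)
qed

text \<open>
  Every step of \<open>M\<close> is simulated within a block of \<open>z\<close> consecutive layers, since these read
  all variables; and a shortest accepting run has at most \<open>W * W\<close> steps.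
\<close>

lemma sim_bp_complete:
  assumes "ntm_accepts M x"
  shows "bp_accepts P y"
proof -
  let ?E = "layers B S n"
  have Wpos: "0 < W" using radix_bounds B_ge by (auto simp: width_def)
  have edge: "bp_reach P y (Suc i) v"
    if "bp_reach P y i u" "i < ?E" "u < W" "v < W" "sim_edge M K B z i u v (y ! (i mod z))" for i u v
    using bp_reach.step[OF that(1), of v] that by (simp add: sim_bp_def)
  have stall: "bp_reach P y (a + t) u" if "bp_reach P y a u" "0 < a" "a + t \<le> ?E" "u < W" for a t u
    using that(3)
  proof (induction t)
    case (Suc t)
    then show ?case using edge[of "a + t" u u] that by (simp add: sim_edge_def)
  qed (use that in simp)
  \<comment> \<open>Steps are recorded as pairs of codes, which makes the relation finite. A path in
    \<open>R\<close> may join different configurations with equal codes; this is harmless, since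
    \<open>round\<close> handles each pair separately.\<close>
  define R where "R = {(code c, code c') | c c'. ntm_reachable M x c \<and> ntm_step M x c c'}"
  have code_less: "code c < W" if "ntm_reachable M x c" for c
    using that reachable_code_bounds(5) by (cases c) auto
  have R: "R \<subseteq> {..<W} \<times> {..<W}"
    unfolding R_def using code_less reachable_step by blast
  have finR: "finite R" using R finite_subset by blast
  have cardR: "card R \<le> W * W"
    using card_mono[OF _ R] by (simp add: card_cartesian_product)
  have round: "bp_reach P y (a + z) v"
    if r: "bp_reach P y a u" "0 < a" "a + z \<le> ?E" and uv: "(u, v) \<in> R" for a u v
  proof -
    obtain c c' where c: "u = code c" "v = code c'" "ntm_reachable M x c" "ntm_step M x c c'"
      using uv unfolding R_def by auto
    obtain tr j where tr: "tr \<in> ntm_delta M" "j < z" "trans_edge K B z tr j (y ! j) u v"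
      using trans_edge_complete[OF c(3,4)] c by auto
    \<comment> \<open>The number of layers to stall until variable \<open>j\<close> is read; the
      summand \<open>z\<close> prevents truncation.\<close>
    define t where "t = (j + z - a mod z) mod z"
    have t: "t < z" unfolding t_def by simp
    have "(a + t) mod z = (a mod z + (j + z - a mod z)) mod z"
      unfolding t_def by (simp add: mod_simps)
    also have "a mod z + (j + z - a mod z) = j + z"
      using mod_less_divisor[of z a] by linarith
    also have "(j + z) mod z = j" using tr(2) by (simp only: mod_add_self2 mod_less)
    finally have j: "(a + t) mod z = j" .
    have uW: "u < W" "v < W" using uv R by auto
    have "bp_reach P y (a + t) u" using stall[OF r(1,2)] t r uW by simp
    then have "bp_reach P y (Suc (a + t)) v"
      using edge[of "a + t" u v] t r uW tr j by (auto simp: sim_edge_def)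
    from stall[OF this, of "z - Suc t"] show ?thesis using t r uW by simp
  qed
  obtain i h w where acc: "ntm_reachable M x (ntm_accept M, i, h, w)"
    using assms unfolding ntm_accepts_def by auto
  let ?acc = "code (ntm_accept M, i, h, w)"
  have "(code (ntm_init M), code c) \<in> R\<^sup>*" if "(ntm_step M x)\<^sup>*\<^sup>* (ntm_init M) c" for c
    using that
  proof (induction rule: rtranclp_induct)
    case (step c c')
    then have "(code c, code c') \<in> R" unfolding R_def ntm_reachable_def by blast
    with step show ?case by (meson rtrancl.rtrancl_into_rtrancl)
  qed simp
  then have "(code (ntm_init M), ?acc) \<in> R\<^sup>*" using acc unfolding ntm_reachable_def by blast
  \<comment> \<open>A shortest path in a finite relation has at most as many steps as the relation
    has pairs; this is the origin of \<open>W * W\<close>.\<close>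
  then obtain k where "k \<le> card R" and k2: "(code (ntm_init M), ?acc) \<in> R ^^ k"
    unfolding rtrancl_finite_eq_relpow[OF finR] by blast
  with cardR have k: "k \<le> W * W" "(code (ntm_init M), ?acc) \<in> R ^^ k" by auto
  have init: "ntm_reachable M x (ntm_init M)" by (simp add: ntm_reachable_def)
  have r1: "bp_reach P y 1 (code (ntm_init M))"
    using edge[OF bp_reach.start _ Wpos code_less[OF init]]
    by (simp add: sim_edge_def code_init layers_def)
  have rounds: "bp_reach P y (1 + t * z) v" if "(code (ntm_init M), v) \<in> R ^^ t" "t \<le> W * W" for t v
    using that
  proof (induction t arbitrary: v)
    case 0
    then show ?case using r1 by simp
  next
    case (Suc t)
    then obtain u where u: "(code (ntm_init M), u) \<in> R ^^ t" "(u, v) \<in> R" by auto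
    have "Suc t * z \<le> (W * W) * z" using Suc.prems(2) by (rule mult_le_mono1)
    then have "1 + t * z + z \<le> ?E" unfolding layers_def by (simp add: algebra_simps)
    then show ?case using round[OF Suc.IH[OF u(1)] _ _ u(2)] Suc.prems by (simp add: algebra_simps)
  qed
  have kz: "k * z \<le> (W * W) * z" using k(1) by (rule mult_le_mono1)
  have E: "?E = 2 + (W * W) * z" by (simp add: layers_def)
  have aW: "?acc < W" using code_less[OF acc] .
  \<comment> \<open>Stalling fills the rounds that remain, up to the last gap, which leads into the
    sink.\<close>
  have "bp_reach P y (1 + (W * W) * z) ?acc"
    using stall[OF rounds[OF k(2,1)], of "(W * W) * z - k * z"] kz aW E by simp
  moreover have "?acc mod K = ntm_accept M"
    by (rule conf_code_decode) (use reachable_code_bounds acc in auto)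
  ultimately have "bp_reach P y ?E 0"
    using edge[of "1 + (W * W) * z" ?acc 0] aW Wpos E by (simp add: sim_edge_def)
  then show ?thesis
    using bp_accepts_iff_reach[of P ?E] by (simp add: sim_bp_def)
qed

end

lemma wf_sim_bp: "2 \<le> B \<Longrightarrow> wf_bp (sim_bp M B S n)"
  by (auto simp: wf_bp_def sim_bp_def width_def radix_def Suc_le_eq)

lemma bp_size_sim_bp: "bp_size (sim_bp M B S n) \<le> layers B S n * (width B S n * (width B S n * 2))"
proof -
  have "bp_edges (sim_bp M B S n) \<subseteq>
      {..<layers B S n} \<times> {..<width B S n} \<times> {..<width B S n} \<times> UNIV"
    by (auto simp: sim_bp_def)
  from card_mono[OF _ this] show ?thesis
    by (simp add: bp_size_def card_cartesian_product mult_2_right UNIV_bool)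
qed

section \<open>The reduction program\<close>

abbreviation plus_exp (infixl \<open>\<oplus>\<close> 65) where "a \<oplus> b \<equiv> Bin Plus a b"
abbreviation minus_exp (infixl \<open>\<ominus>\<close> 65) where "a \<ominus> b \<equiv> Bin Minus a b"
abbreviation times_exp (infixl \<open>\<otimes>\<close> 70) where "a \<otimes> b \<equiv> Bin Times a b"
abbreviation div_exp (infixl \<open>\<oslash>\<close> 70) where "a \<oslash> b \<equiv> Bin Divide a b"

definition mod_exp :: "aexp \<Rightarrow> aexp \<Rightarrow> aexp" where
  "mod_exp a b = a \<ominus> (a \<oslash> b) \<otimes> b"

text \<open>Truth values are 0 and 1: \<open>1 - (1 - a)\<close> caps \<open>a\<close> at 1.
  Likewise, for equality, the two truncated differences of \<open>a\<close> and \<open>b\<close> are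
  both 0 exactly when \<open>a = b\<close>.\<close>

definition sgn_exp :: "aexp \<Rightarrow> aexp" where
  "sgn_exp a = Num 1 \<ominus> (Num 1 \<ominus> a)"

definition less_exp :: "aexp \<Rightarrow> aexp \<Rightarrow> aexp" where
  "less_exp a b = sgn_exp (b \<ominus> a)"

definition eq_exp :: "aexp \<Rightarrow> aexp \<Rightarrow> aexp" where
  "eq_exp a b = Num 1 \<ominus> ((a \<ominus> b) \<oplus> (b \<ominus> a))"

fun sum_exp :: "aexp list \<Rightarrow> aexp" where
  "sum_exp [] = Num 0"
| "sum_exp (e # es) = e \<oplus> sum_exp es"

fun power_exp :: "aexp \<Rightarrow> nat \<Rightarrow> aexp" where
  "power_exp e 0 = Num 1"
| "power_exp e (Suc k) = e \<otimes> power_exp e k"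

lemma eval_exps [simp]:
  "eval (mod_exp a b) \<sigma> = eval a \<sigma> mod eval b \<sigma>"
  "eval (sgn_exp a) \<sigma> = of_bool (0 < eval a \<sigma>)"
  "eval (less_exp a b) \<sigma> = of_bool (eval a \<sigma> < eval b \<sigma>)"
  "eval (eq_exp a b) \<sigma> = of_bool (eval a \<sigma> = eval b \<sigma>)"
  "eval (power_exp a k) \<sigma> = eval a \<sigma> ^ k"
  by (induction k) (auto simp: mod_exp_def sgn_exp_def less_exp_def eq_exp_def minus_div_mult_eq_mod)

lemma eval_sum_exp: "0 < eval (sum_exp es) \<sigma> \<longleftrightarrow> (\<exists>e\<in>set es. 0 < eval e \<sigma>)"
  by (induction es) auto

fun symbol_exp :: "aexp \<Rightarrow> insym \<Rightarrow> aexp \<Rightarrow> aexp \<Rightarrow> aexp" where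
  "symbol_exp z LeftEnd j m = eq_exp j (Num 0)"
| "symbol_exp z RightEnd j m = eq_exp j (z \<ominus> Num 1)"
| "symbol_exp z (Bit b) j m =
     less_exp (Num 0) j \<otimes> less_exp j (z \<ominus> Num 1) \<otimes> eq_exp m (Num (of_bool b))"

fun head_move_exp :: "aexp \<Rightarrow> dir \<Rightarrow> aexp \<Rightarrow> aexp" where
  "head_move_exp z MoveL i = i \<ominus> Num 1"
| "head_move_exp z Stay i = i"
| "head_move_exp z MoveR i = (i \<oplus> Num 1) \<ominus> ((i \<oplus> Num 1) \<ominus> (z \<ominus> Num 1))"

fun power_move_exp :: "aexp \<Rightarrow> dir \<Rightarrow> aexp \<Rightarrow> aexp" where
  "power_move_exp G MoveL P = (P \<oslash> G) \<oplus> (Num 1 \<ominus> (P \<oslash> G))"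
| "power_move_exp G Stay P = P"
| "power_move_exp G MoveR P = P \<otimes> G"

fun trans_exp :: "aexp \<Rightarrow> aexp \<Rightarrow> aexp \<Rightarrow> nat \<times> insym \<times> nat \<times> nat \<times> nat \<times> dir \<times> dir \<Rightarrow>
    aexp \<Rightarrow> aexp \<Rightarrow> aexp \<Rightarrow> aexp \<Rightarrow> aexp" where
  "trans_exp K G z (q, s, g, q', g', d, d') j m u v =
     (let i = mod_exp (u \<oslash> K) K; P = mod_exp (u \<oslash> K \<oslash> K) K; w = u \<oslash> K \<oslash> K \<oslash> K
      in eq_exp (mod_exp u K) (Num q) \<otimes> eq_exp i j \<otimes> symbol_exp z s j m \<otimes>
         eq_exp (mod_exp (w \<oslash> P) G) (Num g) \<otimes>
         eq_exp v (Num q' \<oplus> K \<otimes> (head_move_exp z d i \<oplus> K \<otimes> (power_move_exp G d' P \<oplus>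
           K \<otimes> (w \<oplus> Num g' \<otimes> P \<ominus> Num g \<otimes> P)))))"

text \<open>Products are conjunctions and sums are disjunctions; a sum can exceed 1, hence the outer
  \<open>sgn_exp\<close>. The factors \<open>eq_exp i (Num 0)\<close> and \<open>sgn_exp i\<close>
  replace the case distinction on the layer.\<close>

definition edge_exp :: "nat \<Rightarrow> nat \<Rightarrow> (nat \<times> insym \<times> nat \<times> nat \<times> nat \<times> dir \<times> dir) list \<Rightarrow>
    aexp \<Rightarrow> aexp \<Rightarrow> aexp \<Rightarrow> aexp \<Rightarrow> aexp \<Rightarrow> aexp \<Rightarrow> aexp \<Rightarrow> aexp" where
  "edge_exp q0 qa trs K G z i u v m =
     sgn_exp (eq_exp i (Num 0) \<otimes> (eq_exp u (Num 0) \<otimes> eq_exp v (Num q0 \<oplus> K \<otimes> K)) \<oplus>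
       sgn_exp i \<otimes> (eq_exp u v \<oplus> eq_exp v (Num 0) \<otimes> eq_exp (mod_exp u K) (Num qa) \<oplus>
         sum_exp (map (\<lambda>tr. trans_exp K G z tr (mod_exp i z) m u v) trs)))"

lemma eval_symbol_exp:
  "eval m \<sigma> = of_bool b \<Longrightarrow>
     eval (symbol_exp z s j m) \<sigma> = of_bool (symbol_edge (eval z \<sigma>) s (eval j \<sigma>) b)"
  by (cases s) auto

lemma eval_move_exps:
  "eval (head_move_exp z d i) \<sigma> = head_move (eval z \<sigma>) d (eval i \<sigma>)"
  "eval (power_move_exp G d P) \<sigma> = power_move (eval G \<sigma>) d (eval P \<sigma>)"
  by (cases d; simp)+

lemma eval_trans_exp:
  "eval m \<sigma> = of_bool b \<Longrightarrow> eval (trans_exp K G z tr j m u v) \<sigma> =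
     of_bool (trans_edge (eval K \<sigma>) (eval G \<sigma>) (eval z \<sigma>) tr (eval j \<sigma>) b (eval u \<sigma>) (eval v \<sigma>))"
  by (cases tr) (simp add: Let_def eval_symbol_exp eval_move_exps flip: of_bool_conj)

lemma eval_edge_exp:
  assumes "eval m \<sigma> = of_bool b" "set trs = ntm_delta M"
  shows "eval (edge_exp (ntm_start M) (ntm_accept M) trs K G z i u v m) \<sigma> =
     of_bool (sim_edge M (eval K \<sigma>) (eval G \<sigma>) (eval z \<sigma>) (eval i \<sigma>) (eval u \<sigma>) (eval v \<sigma>) b)"
  using assms
  by (auto simp: edge_exp_def sim_edge_def eval_trans_exp eval_sum_exp)

section \<open>Triples for programs that stream their output\<close>

definition holds :: "(nat \<times> nat) list \<Rightarrow> (nat \<Rightarrow> nat) \<Rightarrow> bool" where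
  "holds vs \<sigma> \<longleftrightarrow> (\<forall>(x, v) \<in> set vs. \<sigma> x = v)"

lemma holds_simps [simp]:
  "holds [] \<sigma>" "holds ((x, v) # vs) \<sigma> \<longleftrightarrow> \<sigma> x = v \<and> holds vs \<sigma>"
  by (auto simp: holds_def)

text \<open>Variables outside \<open>vs\<close> are forgotten, so loop counters and temporaries can
  be reused freely.\<close>

definition state_at :: "(nat \<times> nat) list \<Rightarrow> nat list \<Rightarrow> nat list \<Rightarrow> assertion" where
  "state_at vs inp out = (\<lambda>\<sigma> i o'. holds vs \<sigma> \<and> i = inp \<and> o' = out)"

text \<open>The loop rule for loops that preserve \<open>vs\<close> and otherwise only consume input
  and print. As \<open>x\<close> does not occur in \<open>vs\<close>, changing the counter leaves
  \<open>holds vs\<close> intact.\<close>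

lemma hoare_For_stream:
  assumes e: "\<And>\<sigma>. holds vs \<sigma> \<Longrightarrow> eval e \<sigma> = m" and x: "x \<notin> fst ` set vs" and m: "m \<le> X"
    and body: "\<And>j out. j < m \<Longrightarrow> hoare Z X (state_at ((x, j) # vs) (In j) out) c k
                (state_at ((x, j) # vs) (In (Suc j)) (out @ f j))"
  shows "hoare Z X (state_at vs (In 0) out) (For x e c) (m * (k + 1) + 1)
           (state_at vs (In m) (out @ concat (map f [0..<m])))"
proof -
  have upd: "holds vs (\<sigma>(x := a)) \<longleftrightarrow> holds vs \<sigma>" for \<sigma> a
    using x by (force simp: holds_def)
  show ?thesis
  proof (rule hoare_For[where I = "\<lambda>j. state_at vs (In j) (out @ concat (map f [0..<j]))"])
    show "hoare Z X (\<lambda>\<sigma> i o'. state_at vs (In j) (out @ concat (map f [0..<j])) \<sigma> i o' \<and> \<sigma> x = j) c k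
        (\<lambda>\<sigma> i o'. \<sigma> x = j \<and> state_at vs (In (Suc j)) (out @ concat (map f [0..<Suc j])) (\<sigma>(x := Suc j)) i o')"
      if "j < m" for j
      by (rule hoare_weaken[OF body[OF that, of "out @ concat (map f [0..<j])"]])
        (auto simp: state_at_def upd)
  qed (use e upd m in \<open>auto simp: state_at_def\<close>)
qed

section \<open>Computing the parameters of the branching program\<close>

definition log_ceil :: "nat \<Rightarrow> nat" where
  "log_ceil n = (LEAST l. 2 * n \<le> 2 ^ l)"

lemma log_ceil_le: "log_ceil n \<le> 2 * n"
  unfolding log_ceil_def by (rule Least_le) (simp add: less_imp_le)

lemma le_power_log_ceil: "2 * n \<le> 2 ^ log_ceil n"
  unfolding log_ceil_def by (rule LeastI[of _ "2 * n"]) (simp add: less_imp_le)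

lemma power_less_log_ceil: "l < log_ceil n \<Longrightarrow> 2 ^ l < 2 * n"
  unfolding log_ceil_def using not_less_Least by (metis not_le)

text \<open>By minimality the previous power is below \<open>2 * n\<close>; the summand 1 is for
  \<open>n = 0\<close>.\<close>

lemma power_log_ceil_le: "2 ^ log_ceil n \<le> 4 * n + 1"
proof (cases "log_ceil n")
  case (Suc l)
  then show ?thesis using power_less_log_ceil[of l n] by simp
qed simp

text \<open>Variables 3 and 4 hold \<open>l\<close> and \<open>2 ^ l\<close>. A \<open>For\<close>
  loop has no early exit, so it makes \<open>2 * n\<close> rounds, enough by
  \<open>log_ceil_le\<close>, and the factor \<open>less_exp\<close> disables the rounds after
  \<open>l = log_ceil n\<close>. Variables 5 to 9 become \<open>S\<close>, \<open>B ^ S\<close>, the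
  radix, the width and the number of layers.\<close>

definition params_cmd :: "nat \<Rightarrow> nat \<Rightarrow> nat \<Rightarrow> cmd" where
  "params_cmd B c k =
     Input 0 ;;
     Input 1 ;;
     Assign 2 (Num 2 \<otimes> Var 1 \<oplus> Num 2) ;;
     Assign 3 (Num 0) ;;
     Assign 4 (Num 1) ;;
     For 10 (Num 2 \<otimes> Var 1)
       (Assign 3 (Var 3 \<oplus> less_exp (Var 4) (Num 2 \<otimes> Var 1)) ;;
        Assign 4 (Var 4 \<oplus> Var 4 \<otimes> less_exp (Var 4) (Num 2 \<otimes> Var 1))) ;;
     Assign 5 (Num c \<otimes> power_exp (Var 3) k \<oplus> Num c) ;;
     Assign 6 (Num 1) ;;
     For 10 (Var 5) (Assign 6 (Var 6 \<otimes> Num B)) ;;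
     Assign 7 ((Var 2 \<oplus> Num B) \<otimes> Var 6) ;;
     Assign 8 (Var 7 \<otimes> Var 7 \<otimes> Var 7 \<otimes> Var 7) ;;
     Assign 9 (Num 2 \<oplus> Var 2 \<otimes> (Var 8 \<otimes> Var 8))"

definition space_bound :: "nat \<Rightarrow> nat \<Rightarrow> nat \<Rightarrow> nat" where
  "space_bound c k n = c * log_ceil n ^ k + c"

definition env :: "nat \<Rightarrow> nat \<Rightarrow> nat \<Rightarrow> nat \<Rightarrow> (nat \<times> nat) list" where
  "env B S N n = [(0, N), (1, n), (2, 2 * n + 2), (7, radix B S n), (8, width B S n), (9, layers B S n)]"

text \<open>The number of layers dominates all other parameters, so a single condition on it bounds
  every variable derived from \<open>n\<close>. The space is covered through
  \<open>S < 2 ^ S \<le> B ^ S\<close>.\<close>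

lemma layers_bounds:
  assumes "2 \<le> B"
  shows "B ^ S \<le> radix B S n" "radix B S n \<le> width B S n" "width B S n \<le> layers B S n"
    "4 * n + 4 \<le> layers B S n" "S \<le> radix B S n"
proof -
  have p: "1 \<le> B ^ S" using assms by simp
  show K1: "B ^ S \<le> radix B S n" by (simp add: radix_def)
  have K: "2 * n + 2 \<le> radix B S n"
    unfolding radix_def using mult_le_mono2[OF p, of "2 * n + 2 + B"] by simp
  have "radix B S n * 1 \<le> radix B S n * (radix B S n * radix B S n * radix B S n)"
    using K by (intro mult_le_mono2) simp
  then show W: "radix B S n \<le> width B S n" by (simp add: width_def mult.assoc)
  have W2: "width B S n * 1 \<le> width B S n * width B S n" using K W by (intro mult_le_mono2) simp
  have "width B S n * width B S n \<le> (2 * n + 2) * (width B S n * width B S n)" by simp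
  then show "width B S n \<le> layers B S n" using W2 unfolding layers_def by linarith
  have "(2 * n + 2) * 2 \<le> (2 * n + 2) * (width B S n * width B S n)"
    using K W W2 by (intro mult_le_mono2) linarith
  then show "4 * n + 4 \<le> layers B S n" unfolding layers_def by simp
  have "S < 2 ^ S" by simp
  also have "(2::nat) ^ S \<le> B ^ S" using assms by (rule power_mono) simp
  finally show "S \<le> radix B S n" using K1 by simp
qed

lemma hoare_params_cmd:
  assumes B: "2 \<le> B" and S: "S = space_bound c k n" and N: "N \<le> X" and E: "layers B S n \<le> X"
  shows "hoare Z X (\<lambda>\<sigma> i out. i = N # n # rest \<and> out = []) (params_cmd B c k)
           (13 + 6 * n + 2 * S) (state_at (env B S N n) rest [])"
proof -
  note b = layers_bounds[OF B, where S = S and n = n]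
  let ?v = "[(0, N), (1, n)]" and ?lg = "log_ceil n"
  let ?a = "[(0, N), (1, n), (2, 2 * n + 2)]"
  have nX: "4 * n + 4 \<le> X" using b E by simp
  have 1: "hoare Z X (\<lambda>\<sigma> i out. i = N # n # rest \<and> out = []) (Input 0) 1 (state_at [(0, N)] (n # rest) [])"
    by (rule hoare_Input) (use N in \<open>auto simp: state_at_def\<close>)
  have 2: "hoare Z X (state_at [(0, N)] (n # rest) []) (Input 1) 1 (state_at ?v rest [])"
    by (rule hoare_Input) (use nX in \<open>auto simp: state_at_def\<close>)
  have 3: "hoare Z X (state_at ?v rest []) (Assign 2 (Num 2 \<otimes> Var 1 \<oplus> Num 2)) 1 (state_at ?a rest [])"
    by (rule hoare_Assign) (use nX in \<open>auto simp: state_at_def\<close>)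
  have 4: "hoare Z X (state_at ?a rest []) (Assign 3 (Num 0)) 1 (state_at ((3, 0) # ?a) rest [])"
    by (rule hoare_Assign) (auto simp: state_at_def)
  have 5: "hoare Z X (state_at ((3, 0) # ?a) rest []) (Assign 4 (Num 1)) 1 (state_at ((4, 1) # (3, 0) # ?a) rest [])"
    by (rule hoare_Assign) (use nX in \<open>auto simp: state_at_def\<close>)
  let ?I = "\<lambda>t. state_at ((4, 2 ^ min t ?lg) # (3, min t ?lg) # ?a) rest []"
  let ?lt = "less_exp (Var 4) (Num 2 \<otimes> Var 1)"
  have pX: "2 ^ min t ?lg \<le> X" for t
  proof -
    have "(2::nat) ^ min t ?lg \<le> 2 ^ ?lg" by (rule power_increasing) auto
    then show ?thesis using power_log_ceil_le[of n] nX by linarith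
  qed
  have lt: "2 ^ min t ?lg < 2 * n \<longleftrightarrow> t < ?lg" for t
    using power_less_log_ceil[of t n] le_power_log_ceil[of n] by (cases "t < ?lg") auto
  have mins: "min (Suc t) ?lg = min t ?lg + of_bool (t < ?lg)" for t by auto
  have 6: "hoare Z X (state_at ((4, 1) # (3, 0) # ?a) rest []) (For 10 (Num 2 \<otimes> Var 1)
       (Assign 3 (Var 3 \<oplus> ?lt) ;; Assign 4 (Var 4 \<oplus> Var 4 \<otimes> ?lt))) (2 * n * ((1 + 1) + 1) + 1) (?I (2 * n))"
  proof (rule hoare_For[where I = ?I])
    fix t assume "t < 2 * n"
    show "hoare Z X (\<lambda>\<sigma> i out. ?I t \<sigma> i out \<and> \<sigma> 10 = t)
       (Assign 3 (Var 3 \<oplus> ?lt) ;; Assign 4 (Var 4 \<oplus> Var 4 \<otimes> ?lt)) (1 + 1)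
       (\<lambda>\<sigma> i out. \<sigma> 10 = t \<and> ?I (Suc t) (\<sigma>(10 := Suc t)) i out)"
    proof (rule hoare_Seq)
      show "hoare Z X (\<lambda>\<sigma> i out. ?I t \<sigma> i out \<and> \<sigma> 10 = t) (Assign 3 (Var 3 \<oplus> ?lt)) 1
        (state_at ((10, t) # (4, 2 ^ min t ?lg) # (3, min (Suc t) ?lg) # ?a) rest [])"
        by (rule hoare_Assign) (use lt[of t] mins[of t] log_ceil_le[of n] nX in \<open>auto simp: state_at_def\<close>)
      show "hoare Z X (state_at ((10, t) # (4, 2 ^ min t ?lg) # (3, min (Suc t) ?lg) # ?a) rest [])
         (Assign 4 (Var 4 \<oplus> Var 4 \<otimes> ?lt)) 1
         (\<lambda>\<sigma> i out. \<sigma> 10 = t \<and> ?I (Suc t) (\<sigma>(10 := Suc t)) i out)"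
        by (rule hoare_Assign)
          (use lt[of t] mins[of t] pX[of "Suc t"] pX[of t] in \<open>auto simp: state_at_def min_def\<close>)
    qed
  qed (use nX in \<open>auto simp: state_at_def\<close>)
  have lg: "min (2 * n) ?lg = ?lg" using log_ceil_le[of n] by simp
  have SX: "S \<le> X" using b E by linarith
  have 7: "hoare Z X (?I (2 * n)) (Assign 5 (Num c \<otimes> power_exp (Var 3) k \<oplus> Num c)) 1
      (state_at ((5, S) # ?a) rest [])"
    unfolding lg
    by (rule hoare_Assign) (use SX in \<open>auto simp: state_at_def S space_bound_def\<close>)
  have 8: "hoare Z X (state_at ((5, S) # ?a) rest []) (Assign 6 (Num 1)) 1 (state_at ((6, 1) # (5, S) # ?a) rest [])"
    by (rule hoare_Assign) (use nX in \<open>auto simp: state_at_def\<close>)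
  have 9: "hoare Z X (state_at ((6, 1) # (5, S) # ?a) rest []) (For 10 (Var 5) (Assign 6 (Var 6 \<otimes> Num B)))
     (S * (1 + 1) + 1) (state_at ((6, B ^ S) # (5, S) # ?a) rest [])"
  proof (rule hoare_For[where I = "\<lambda>t. state_at ((6, B ^ t) # (5, S) # ?a) rest []"])
    fix t assume t: "t < S"
    have "B ^ Suc t \<le> B ^ S" using t B by (intro power_increasing) auto
    then have "B ^ Suc t \<le> X" using b E by linarith
    then show "hoare Z X (\<lambda>\<sigma> i out. state_at ((6, B ^ t) # (5, S) # ?a) rest [] \<sigma> i out \<and> \<sigma> 10 = t)
       (Assign 6 (Var 6 \<otimes> Num B)) 1
       (\<lambda>\<sigma> i out. \<sigma> 10 = t \<and> state_at ((6, B ^ Suc t) # (5, S) # ?a) rest [] (\<sigma>(10 := Suc t)) i out)"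
      by (intro hoare_Assign) (auto simp: state_at_def mult.commute)
  qed (use SX in \<open>auto simp: state_at_def\<close>)
  let ?K = "radix B S n" and ?W = "width B S n" and ?E = "layers B S n"
  have 10: "hoare Z X (state_at ((6, B ^ S) # (5, S) # ?a) rest []) (Assign 7 ((Var 2 \<oplus> Num B) \<otimes> Var 6)) 1
     (state_at ((7, ?K) # ?a) rest [])"
    by (rule hoare_Assign) (use b E in \<open>auto simp: state_at_def radix_def\<close>)
  have 11: "hoare Z X (state_at ((7, ?K) # ?a) rest []) (Assign 8 (Var 7 \<otimes> Var 7 \<otimes> Var 7 \<otimes> Var 7)) 1
     (state_at ((8, ?W) # (7, ?K) # ?a) rest [])"
    by (rule hoare_Assign) (use b E in \<open>auto simp: state_at_def width_def\<close>)
  have 12: "hoare Z X (state_at ((8, ?W) # (7, ?K) # ?a) rest []) (Assign 9 (Num 2 \<oplus> Var 2 \<otimes> (Var 8 \<otimes> Var 8))) 1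
     (state_at (env B S N n) rest [])"
    by (rule hoare_Assign) (use E in \<open>auto simp: state_at_def env_def layers_def\<close>)
  show ?thesis
    unfolding params_cmd_def
    by (rule hoare_weaken[OF hoare_Seq[OF 1 hoare_Seq[OF 2 hoare_Seq[OF 3 hoare_Seq[OF 4
      hoare_Seq[OF 5 hoare_Seq[OF 6 hoare_Seq[OF 7 hoare_Seq[OF 8 hoare_Seq[OF 9
      hoare_Seq[OF 10 hoare_Seq[OF 11 12]]]]]]]]]]]]) auto
qed

section \<open>Printing the branching program and copying the strings\<close>

definition bp_cmd :: "ntm \<Rightarrow> nat \<Rightarrow> (nat \<times> insym \<times> nat \<times> nat \<times> nat \<times> dir \<times> dir) list \<Rightarrow> cmd" where
  "bp_cmd M B trs =
     Output (Var 2) ;;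
     Output (Var 9 \<oplus> Num 1) ;;
     Output (Var 8) ;;
     For 10 (Var 9) (Output (mod_exp (Var 10) (Var 2))) ;;
     For 10 (Var 9) (For 11 (Var 8) (For 12 (Var 8) (For 13 (Num 2)
       (Output (edge_exp (ntm_start M) (ntm_accept M) trs (Var 7) (Num B) (Var 2)
          (Var 10) (Var 11) (Var 12) (Var 13))))))"

lemma hoare_bp_cmd:
  assumes B: "2 \<le> B" and trs: "set trs = ntm_delta M" and E: "layers B S n \<le> X"
  defines "E' \<equiv> layers B S n" and "W \<equiv> width B S n"
  shows "hoare Z X (state_at (env B S N n) rest []) (bp_cmd M B trs)
           (5 + 2 * E' + E' * (W * (W * 6 + 2) + 2))
           (state_at (env B S N n) rest (bp_code (sim_bp M B S n)))"
proof -
  note b = layers_bounds[OF B, where S = S and n = n]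
  let ?v = "env B S N n" and ?K = "radix B S n" and ?z = "2 * n + 2"
  let ?P = "sim_bp M B S n"
  have WX: "W \<le> X" "E' \<le> X" "2 \<le> X" using b E by (simp_all add: W_def E'_def)
  have env: "\<sigma> 2 = ?z \<and> \<sigma> 7 = ?K \<and> \<sigma> 8 = W \<and> \<sigma> 9 = E'" if "holds ?v \<sigma>" for \<sigma>
    using that by (simp add: env_def W_def E'_def)
  have 1: "hoare Z X (state_at ?v rest []) (Output (Var 2)) 1 (state_at ?v rest [?z])"
    by (rule hoare_Output) (auto simp: state_at_def env)
  have 2: "hoare Z X (state_at ?v rest [?z]) (Output (Var 9 \<oplus> Num 1)) 1 (state_at ?v rest [?z, E' + 1])"
    by (rule hoare_Output) (auto simp: state_at_def env)
  have 3: "hoare Z X (state_at ?v rest [?z, E' + 1]) (Output (Var 8)) 1 (state_at ?v rest [?z, E' + 1, W])"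
    by (rule hoare_Output) (auto simp: state_at_def env)
  let ?o = "[?z, E' + 1, W] @ concat (map (\<lambda>i. [i mod ?z]) [0..<E'])"
  have 4: "hoare Z X (state_at ?v rest [?z, E' + 1, W]) (For 10 (Var 9) (Output (mod_exp (Var 10) (Var 2))))
     (E' * (1 + 1) + 1) (state_at ?v rest ?o)"
  proof (rule hoare_For_stream[where In = "\<lambda>_. rest"])
    fix j out
    show "hoare Z X (state_at ((10, j) # ?v) rest out) (Output (mod_exp (Var 10) (Var 2))) 1
         (state_at ((10, j) # ?v) rest (out @ [j mod ?z]))"
      by (rule hoare_Output) (auto simp: state_at_def env)
  qed (use WX in \<open>auto simp: env_def W_def E'_def\<close>)
  let ?e = "edge_exp (ntm_start M) (ntm_accept M) trs (Var 7) (Num B) (Var 2)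
          (Var 10) (Var 11) (Var 12) (Var 13)"
  \<comment> \<open>The innermost counter takes the values 0 and 1 and stands for the marks
    \<open>False\<close> and \<open>True\<close>; the nesting of the loops is the order of the
    entries in \<open>bp_code\<close>.\<close>
  let ?f = "\<lambda>i u v m. of_bool ((i, u, v, m = 1) \<in> bp_edges ?P) :: nat"
  let ?o' = "concat (map (\<lambda>i. concat (map (\<lambda>u. concat (map (\<lambda>v. concat (map (\<lambda>m. [?f i u v m])
        [0..<2])) [0..<W])) [0..<W])) [0..<E'])"
  have 5: "hoare Z X (state_at ?v rest ?o) (For 10 (Var 9) (For 11 (Var 8) (For 12 (Var 8) (For 13 (Num 2)
       (Output ?e))))) (E' * ((W * ((W * ((2 * (1 + 1) + 1) + 1) + 1) + 1) + 1) + 1) + 1)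
       (state_at ?v rest (?o @ ?o'))"
  proof (rule hoare_For_stream[where In = "\<lambda>_. rest"])
    fix i out assume i: "i < E'"
    let ?v1 = "(10, i) # ?v"
    show "hoare Z X (state_at ?v1 rest out) (For 11 (Var 8) (For 12 (Var 8) (For 13 (Num 2) (Output ?e))))
      (W * ((W * ((2 * (1 + 1) + 1) + 1) + 1) + 1) + 1)
      (state_at ?v1 rest (out @ concat (map (\<lambda>u. concat (map (\<lambda>v. concat (map (\<lambda>m. [?f i u v m])
        [0..<2])) [0..<W])) [0..<W])))"
    proof (rule hoare_For_stream[where In = "\<lambda>_. rest"])
      fix u out assume u: "u < W"
      let ?v2 = "(11, u) # ?v1"
      show "hoare Z X (state_at ?v2 rest out) (For 12 (Var 8) (For 13 (Num 2) (Output ?e)))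
        (W * ((2 * (1 + 1) + 1) + 1) + 1)
        (state_at ?v2 rest (out @ concat (map (\<lambda>v. concat (map (\<lambda>m. [?f i u v m]) [0..<2])) [0..<W])))"
      proof (rule hoare_For_stream[where In = "\<lambda>_. rest"])
        fix v out assume v: "v < W"
        let ?v3 = "(12, v) # ?v2"
        show "hoare Z X (state_at ?v3 rest out) (For 13 (Num 2) (Output ?e)) (2 * (1 + 1) + 1)
          (state_at ?v3 rest (out @ concat (map (\<lambda>m. [?f i u v m]) [0..<2])))"
        proof (rule hoare_For_stream[where In = "\<lambda>_. rest"])
          fix m :: nat and out assume m: "m < 2"
          have "eval ?e \<sigma> = ?f i u v m" if h: "holds ((13, m) # ?v3) \<sigma>" for \<sigma>
          proof -
            have m': "eval (Var 13) \<sigma> = of_bool (m = 1)" using h less_2_cases[OF m] by auto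
            show ?thesis
              unfolding eval_edge_exp[OF m' trs]
              using h i u v by (auto simp: sim_bp_def env_def W_def E'_def)
          qed
          then show "hoare Z X (state_at ((13, m) # ?v3) rest out) (Output ?e) 1
             (state_at ((13, m) # ?v3) rest (out @ [?f i u v m]))"
            by (intro hoare_Output) (auto simp: state_at_def simp del: holds_simps)
        qed (use WX in \<open>auto simp: env_def W_def E'_def\<close>)
      qed (use WX in \<open>auto simp: env_def W_def E'_def\<close>)
    qed (use WX in \<open>auto simp: env_def W_def E'_def\<close>)
  qed (use WX in \<open>auto simp: env_def W_def E'_def\<close>)
  have code: "bp_code ?P = ?o @ ?o'"
    by (simp add: bp_code_def sim_bp_def E'_def W_def numeral_2_eq_2 concat_map_singleton)
  show ?thesis
    unfolding bp_cmd_def code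
    by (rule hoare_weaken[OF hoare_Seq[OF 1 hoare_Seq[OF 2 hoare_Seq[OF 3 hoare_Seq[OF 4 5]]]]])
      (auto simp: algebra_simps)
qed

definition copy_row :: cmd where
  "copy_row = For 11 (Var 1) (Input 12 ;; Output (Var 12))"

text \<open>Padding amounts to announcing length \<open>n + 1\<close> and printing one extra 0 per
  string, in front for the first set and behind for the second. No string is ever held in
  memory.\<close>

definition copy_cmd :: cmd where
  "copy_cmd =
     Output (Var 0) ;;
     Output (Var 1 \<oplus> Num 1) ;;
     For 10 (Var 0) (Output (Num 0) ;; copy_row) ;;
     For 10 (Var 0) (copy_row ;; Output (Num 0))"

lemma hoare_copy_row:
  assumes "length a = n" "n \<le> X" "1 \<le> X"
  shows "hoare Z X (state_at [(10, j), (0, N), (1, n)] (map of_bool a @ rest) out) copy_row (n * 3 + 1)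
           (state_at [(10, j), (0, N), (1, n)] rest (out @ map of_bool a))"
proof -
  let ?v = "[(10, j), (0, N), (1, n)]"
  have "hoare Z X (state_at ?v (drop 0 (map of_bool a) @ rest) out) copy_row (n * ((1 + 1) + 1) + 1)
           (state_at ?v (drop n (map of_bool a) @ rest)
              (out @ concat (map (\<lambda>j. [map of_bool a ! j]) [0..<n])))"
    unfolding copy_row_def
  proof (rule hoare_For_stream[where In = "\<lambda>j. drop j (map of_bool a) @ rest"])
    fix i out assume i: "i < n"
    let ?b = "map of_bool a ! i :: nat"
    show "hoare Z X (state_at ((11, i) # ?v) (drop i (map of_bool a) @ rest) out) (Input 12 ;; Output (Var 12))
      (1 + 1) (state_at ((11, i) # ?v) (drop (Suc i) (map of_bool a) @ rest) (out @ [?b]))"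
    proof (rule hoare_Seq)
      have d: "drop i (map of_bool a) = ?b # drop (Suc i) (map of_bool a)"
        using i assms by (metis Cons_nth_drop_Suc length_map)
      have "?b \<le> X" using i assms by (simp add: of_bool_def)
      then show "hoare Z X (state_at ((11, i) # ?v) (drop i (map of_bool a) @ rest) out) (Input 12) 1
         (state_at ((12, ?b) # (11, i) # ?v) (drop (Suc i) (map of_bool a) @ rest) out)"
        unfolding d by (intro hoare_Input) (auto simp: state_at_def)
      show "hoare Z X (state_at ((12, ?b) # (11, i) # ?v) (drop (Suc i) (map of_bool a) @ rest) out)
         (Output (Var 12)) 1 (state_at ((11, i) # ?v) (drop (Suc i) (map of_bool a) @ rest) (out @ [?b]))"
        by (rule hoare_Output) (auto simp: state_at_def)
    qed
  qed (use assms in auto)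
  moreover have "concat (map (\<lambda>j. [map of_bool a ! j :: nat]) [0..<n]) = map of_bool a"
    using assms map_nth[of "map of_bool a"] by (simp add: concat_map_singleton)
  moreover have "n * ((1 + 1) + 1) + 1 = n * 3 + 1" by simp
  ultimately have "hoare Z X (state_at ?v (drop 0 (map of_bool a) @ rest) out) copy_row (n * 3 + 1)
      (state_at ?v (drop n (map of_bool a) @ rest) (out @ map of_bool a))"
    by (simp only:)
  then show ?thesis using assms by simp
qed

lemma bits_drop:
  "j < length as \<Longrightarrow> bits (drop j as) = map of_bool (as ! j) @ bits (drop (Suc j) as)"
  by (simp add: bits_def flip: Cons_nth_drop_Suc)

lemma concat_rows:
  "length as = N \<Longrightarrow> concat (map (\<lambda>j. map of_bool (f (as ! j))) [0..<N]) = bits (map f as)"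
proof -
  assume N: "length as = N"
  have "map (\<lambda>j. map of_bool (f (as ! j)) :: nat list) [0..<N] = map (\<lambda>a. map of_bool (f a)) as"
    using N by (intro nth_equalityI) auto
  then show ?thesis by (simp only: bits_def map_concat map_map comp_def)
qed

lemma hoare_copy_cmd:
  assumes "length as = N" "length bs = N" "\<forall>a\<in>set as. length a = n" "\<forall>a\<in>set bs. length a = n"
    and X: "N \<le> X" "n \<le> X" "1 \<le> X"
  shows "hoare Z X (state_at (env B S N n) (bits as @ bits bs) out) copy_cmd
           (4 + 2 * N * (n * 3 + 3))
           (\<lambda>\<sigma> i out'. out' = out @ [N, n + 1] @ bits (map ((#) False) as) @
              bits (map (\<lambda>b. b @ [False]) bs))"
proof -
  let ?v = "[(0, N), (1, n)]"
  have 1: "hoare Z X (state_at (env B S N n) (bits as @ bits bs) out) (Output (Var 0)) 1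
     (state_at ?v (bits as @ bits bs) (out @ [N]))"
    by (rule hoare_Output) (auto simp: state_at_def env_def)
  have 2: "hoare Z X (state_at ?v (bits as @ bits bs) (out @ [N])) (Output (Var 1 \<oplus> Num 1)) 1
     (state_at ?v (bits as @ bits bs) (out @ [N, n + 1]))"
    by (rule hoare_Output) (auto simp: state_at_def)
  let ?o = "(out @ [N, n + 1]) @ concat (map (\<lambda>j. map of_bool (False # (as ! j))) [0..<N])"
  have 3: "hoare Z X (state_at ?v (bits (drop 0 as) @ bits bs) (out @ [N, n + 1]))
      (For 10 (Var 0) (Output (Num 0) ;; copy_row)) (N * ((1 + (n * 3 + 1)) + 1) + 1)
      (state_at ?v (bits (drop N as) @ bits bs) ?o)"
  proof (rule hoare_For_stream[where In = "\<lambda>j. bits (drop j as) @ bits bs"])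
    fix j out assume j: "j < N"
    show "hoare Z X (state_at ((10, j) # ?v) (bits (drop j as) @ bits bs) out) (Output (Num 0) ;; copy_row)
      (1 + (n * 3 + 1))
      (state_at ((10, j) # ?v) (bits (drop (Suc j) as) @ bits bs) (out @ map of_bool (False # as ! j)))"
    proof (rule hoare_Seq)
      show "hoare Z X (state_at ((10, j) # ?v) (bits (drop j as) @ bits bs) out) (Output (Num 0)) 1
        (state_at ((10, j) # ?v) (map of_bool (as ! j) @ bits (drop (Suc j) as) @ bits bs) (out @ [0]))"
        using bits_drop[of j as] j assms by (intro hoare_Output) (auto simp: state_at_def)
      show "hoare Z X (state_at ((10, j) # ?v) (map of_bool (as ! j) @ bits (drop (Suc j) as) @ bits bs) (out @ [0]))
        copy_row (n * 3 + 1)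
        (state_at ((10, j) # ?v) (bits (drop (Suc j) as) @ bits bs) (out @ map of_bool (False # as ! j)))"
        using hoare_copy_row[of "as ! j" n X Z j N "bits (drop (Suc j) as) @ bits bs" "out @ [0]"] j assms
        by simp
    qed
  qed (use X in auto)
  let ?o' = "?o @ concat (map (\<lambda>j. map of_bool ((\<lambda>b. b @ [False]) (bs ! j))) [0..<N])"
  have 4: "hoare Z X (state_at ?v (bits (drop 0 bs)) ?o)
      (For 10 (Var 0) (copy_row ;; Output (Num 0))) (N * (((n * 3 + 1) + 1) + 1) + 1)
      (state_at ?v (bits (drop N bs)) ?o')"
  proof (rule hoare_For_stream[where In = "\<lambda>j. bits (drop j bs)"])
    fix j out assume j: "j < N"
    show "hoare Z X (state_at ((10, j) # ?v) (bits (drop j bs)) out) (copy_row ;; Output (Num 0))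
      ((n * 3 + 1) + 1)
      (state_at ((10, j) # ?v) (bits (drop (Suc j) bs)) (out @ map of_bool (bs ! j @ [False])))"
    proof (rule hoare_Seq)
      show "hoare Z X (state_at ((10, j) # ?v) (bits (drop j bs)) out) copy_row (n * 3 + 1)
        (state_at ((10, j) # ?v) (bits (drop (Suc j) bs)) (out @ map of_bool (bs ! j)))"
        using hoare_copy_row[of "bs ! j" n X Z j N "bits (drop (Suc j) bs)" out] bits_drop[of j bs] j assms
        by simp
      show "hoare Z X (state_at ((10, j) # ?v) (bits (drop (Suc j) bs)) (out @ map of_bool (bs ! j))) (Output (Num 0)) 1
        (state_at ((10, j) # ?v) (bits (drop (Suc j) bs)) (out @ map of_bool (bs ! j @ [False])))"
        by (rule hoare_Output) (auto simp: state_at_def)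
    qed
  qed (use X in auto)
  have eq: "bits (drop N as) @ bits bs = bits (drop 0 bs)" "bits as = bits (drop 0 as)"
    using assms by (auto simp: bits_def)
  have o': "?o' = out @ [N, n + 1] @ bits (map ((#) False) as) @ bits (map (\<lambda>b. b @ [False]) bs)"
    unfolding concat_rows[OF assms(2), of "\<lambda>b. b @ [False]"] concat_rows[OF assms(1), of "(#) False"] by simp
  show ?thesis
    unfolding copy_cmd_def
    by (rule hoare_weaken[OF hoare_Seq[OF 1[unfolded eq(2)] hoare_Seq[OF 2[unfolded eq(2)] hoare_Seq[OF 3[unfolded eq(1)] 4[unfolded o']]]]])
      (auto simp: state_at_def algebra_simps)
qed

section \<open>The complete program and its cost\<close>

definition reduction_cmd :: "ntm \<Rightarrow> nat \<Rightarrow> nat \<Rightarrow> nat \<Rightarrow> (nat \<times> insym \<times> nat \<times> nat \<times> nat \<times> dir \<times> dir) list \<Rightarrow> cmd"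
where
  "reduction_cmd M B c k trs = params_cmd B c k ;; bp_cmd M B trs ;; copy_cmd"

text \<open>As \<open>E\<close> dominates \<open>n\<close>, \<open>S\<close> and the width, the
  matrices take \<open>O(E ^ 3)\<close> units and the strings \<open>O(N * E)\<close>; 100 is slack.
  \<open>X\<close> leaves room for the values of all variables and for the register numbers up to
  \<open>2 * Z\<close>.\<close>

lemma reduction_cmd_computes:
  fixes M :: ntm and B c k :: nat and trs
  defines "C \<equiv> reduction_cmd M B c k trs"
  assumes B: "2 \<le> B" and trs: "set trs = ntm_delta M"
    and lens: "length as = N" "length bs = N" "\<forall>a\<in>set as. length a = n" "\<forall>a\<in>set bs. length a = n"
  defines "S \<equiv> space_bound c k n"
  defines "E \<equiv> layers B S n"
  defines "X \<equiv> N + E + 2 * csize C + 2"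
  shows "\<exists>t. ram_computes (compile C 0 (csize C)) ([N, n] @ bits as @ bits bs)
           (bp_code (sim_bp M B S n) @ [N, n + 1] @ bits (map ((#) False) as) @
              bits (map (\<lambda>b. b @ [False]) bs)) t \<and>
           t \<le> 100 * (N + 1) * E ^ 3 * unit_cost (csize C) X"
proof -
  let ?Z = "csize C" and ?W = "width B S n"
  note b = layers_bounds[OF B, where S = S and n = n, folded E_def]
  have X: "N \<le> X" "layers B S n \<le> X" "n \<le> X" "1 \<le> X" using b by (auto simp: X_def E_def)
  let ?k = "(13 + 6 * n + 2 * S) + ((5 + 2 * E + E * (?W * (?W * 6 + 2) + 2)) + (4 + 2 * N * (n * 3 + 3)))"
  have h: "hoare ?Z X (\<lambda>\<sigma> i out. i = [N, n] @ bits as @ bits bs \<and> out = []) C ?k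
     (\<lambda>\<sigma> i out'. out' = bp_code (sim_bp M B S n) @ [N, n + 1] @ bits (map ((#) False) as) @
              bits (map (\<lambda>b. b @ [False]) bs))"
    unfolding C_def reduction_cmd_def
    using hoare_Seq[OF hoare_params_cmd[OF B S_def[THEN meta_eq_to_obj_eq] X(1,2)]
       hoare_Seq[OF hoare_bp_cmd[OF B trs X(2)] hoare_copy_cmd[OF lens X(1,3,4)]]]
    by (simp add: E_def)
  have "?k \<le> 100 * (N + 1) * E ^ 3"
  proof -
    have bd: "n \<le> E" "S \<le> E" "?W \<le> E" "1 \<le> E" using b by linarith+
    have E1: "E \<le> E ^ 3" using bd by (intro self_le_power) auto
    have "?W * (?W * 6 + 2) \<le> E * (E * 6 + 2)" using bd by (intro mult_le_mono) auto
    then have "E * (?W * (?W * 6 + 2) + 2) \<le> E * (E * (E * 6 + 2) + 2)" by simp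
    also have "\<dots> = 6 * E ^ 3 + 2 * E ^ 2 + 2 * E" by (simp add: power3_eq_cube power2_eq_square algebra_simps)
    also have "\<dots> \<le> 10 * E ^ 3" using power_increasing[of 2 3 E] E1 bd by linarith
    finally have e1: "E * (?W * (?W * 6 + 2) + 2) \<le> 10 * E ^ 3" .
    have "2 * N * (n * 3 + 3) \<le> 2 * N * (6 * E ^ 3)"
      using bd E1 by (intro mult_le_mono2) linarith
    then have e2: "2 * N * (n * 3 + 3) \<le> 12 * (N * E ^ 3)" by simp
    have "?k \<le> 50 * E ^ 3 + 12 * (N * E ^ 3)" using e1 e2 bd E1 by linarith
    also have "\<dots> \<le> 100 * (N + 1) * E ^ 3" by (simp add: algebra_simps)
    finally show ?thesis .
  qed
  then have "?k * unit_cost ?Z X \<le> 100 * (N + 1) * E ^ 3 * unit_cost ?Z X" by (rule mult_le_mono1)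
  moreover have "2 * ?Z + 2 \<le> X" by (simp add: X_def)
  ultimately show ?thesis using hoare_ram_computes[OF h HOL.refl] le_trans by blast
qed

section \<open>Growth rates\<close>

lemma eventually_log2_ge: "\<forall>\<^sub>F N in sequentially. C \<le> log 2 (real N)"
  by real_asymp

text \<open>Together with the converse below, this trades the null sequence for an arbitrary fixed
  exponent, so that closure properties become eventual inequalities.\<close>

lemma exp_log_o1D:
  assumes "exp_log_o1 f" "\<delta> > 0"
  shows "\<forall>\<^sub>F N in sequentially. f N \<le> 2 powr (log 2 (real N) powr \<delta>)"
proof -
  obtain \<epsilon> where e: "\<epsilon> \<longlonglongrightarrow> 0"
    "\<forall>\<^sub>F N in sequentially. f N \<le> 2 powr (log 2 (real N) powr \<epsilon> N)"
    using assms(1) unfolding exp_log_o1_def by blast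
  have "\<forall>\<^sub>F N in sequentially. \<epsilon> N < \<delta>" using order_tendstoD(2)[OF e(1) assms(2)] .
  with e(2) eventually_log2_ge[of 1] show ?thesis
  proof eventually_elim
    case (elim N)
    have "log 2 (real N) powr \<epsilon> N \<le> log 2 (real N) powr \<delta>"
      using elim by (intro powr_mono) auto
    then have "2 powr (log 2 (real N) powr \<epsilon> N) \<le> 2 powr (log 2 (real N) powr \<delta>)"
      by (simp only: powr_le_cancel_iff[of 2])
    then show ?case using elim by linarith
  qed
qed

text \<open>Take the exponent for which the required bound is an equality. Where
  \<open>f N \<le> 2\<close>, the iterated logarithm may be negative or meaningless, and exponent 0
  works because it gives the bound 2.\<close>

lemma exp_log_o1I:
  assumes "\<And>\<delta>. \<delta> > 0 \<Longrightarrow> \<forall>\<^sub>F N in sequentially. f N \<le> 2 powr (log 2 (real N) powr \<delta>)"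
  shows "exp_log_o1 f"
proof -
  define \<epsilon> where "\<epsilon> N = (if f N \<le> 2 then 0 else log (log 2 (real N)) (log 2 (f N)))" for N
  have "\<forall>\<^sub>F N in sequentially. dist (\<epsilon> N) 0 < e" if e: "e > 0" for e
    using assms[OF half_gt_zero[OF e]] eventually_log2_ge[of 2]
  proof eventually_elim
    case (elim N)
    note 1 = elim e
    show ?case
    proof (cases "f N \<le> 2")
      case False
      have l1: "1 < log 2 (f N)" using False by (simp add: less_log_iff)
      have "log 2 (f N) \<le> log 2 (real N) powr (e / 2)"
        using 1 False by (simp add: log_le_iff)
      then have "log (log 2 (real N)) (log 2 (f N)) \<le> e / 2"
        using log_le_iff[of "log 2 (real N)" "log 2 (f N)" "e / 2"] l1 1 by linarith
      then have "\<epsilon> N \<le> e / 2" using False by (simp add: \<epsilon>_def)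
      moreover have "0 \<le> \<epsilon> N" using l1 1 False by (simp add: \<epsilon>_def)
      ultimately show ?thesis using 1 by simp
    qed (use 1 in \<open>simp add: \<epsilon>_def\<close>)
  qed
  then have "\<epsilon> \<longlonglongrightarrow> 0" by (rule tendstoI)
  moreover have "\<forall>\<^sub>F N in sequentially. f N \<le> 2 powr (log 2 (real N) powr \<epsilon> N)"
    using eventually_log2_ge[of 2]
  proof eventually_elim
    case (elim N)
    show ?case
    proof (cases "f N \<le> 2")
      case False
      have "1 < log 2 (f N)" using False by (simp add: less_log_iff)
      then have "log 2 (real N) powr \<epsilon> N = log 2 (f N)" using False elim by (simp add: \<epsilon>_def)
      then show ?thesis using False by simp
    qed (use elim in \<open>simp add: \<epsilon>_def\<close>)
  qed
  ultimately show ?thesis unfolding exp_log_o1_def by blast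
qed

text \<open>Again the exact exponent is taken, replaced by 0 where \<open>f N\<close> is at most
  \<open>real N\<close>.\<close>

lemma near_linearI:
  assumes "\<And>\<delta>. \<delta> > 0 \<Longrightarrow> \<forall>\<^sub>F N in sequentially. f N \<le> real N powr (1 + \<delta>)"
  shows "near_linear f"
proof -
  define \<epsilon> where "\<epsilon> N = (if f N \<le> real N then 0 else log (real N) (f N) - 1)" for N
  have "\<forall>\<^sub>F N in sequentially. dist (\<epsilon> N) 0 < e" if e: "e > 0" for e
    using assms[OF half_gt_zero[OF e]] eventually_gt_at_top[of 1]
  proof eventually_elim
    case (elim N)
    note 1 = elim e
    show ?case
    proof (cases "f N \<le> real N")
      case False
      have "log (real N) (f N) \<le> 1 + e / 2" using 1 False by (simp add: log_le_iff)
      moreover have "1 \<le> log (real N) (f N)" using 1 False by (simp add: le_log_iff)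
      ultimately show ?thesis using 1 False by (simp add: \<epsilon>_def)
    qed (use 1 in \<open>simp add: \<epsilon>_def\<close>)
  qed
  then have "\<epsilon> \<longlonglongrightarrow> 0" by (rule tendstoI)
  moreover have "\<forall>\<^sub>F N in sequentially. f N \<le> real N powr (1 + \<epsilon> N)"
    using eventually_gt_at_top[of 1]
  proof eventually_elim
    case (elim N)
    then show ?case by (cases "f N \<le> real N") (auto simp: \<epsilon>_def)
  qed
  ultimately show ?thesis unfolding near_linear_def by blast
qed

text \<open>Half of the exponent is held back to outgrow the constant \<open>C\<close>.\<close>

lemma eventually_mult_powr_log_le:
  assumes "\<delta> > 0"
  shows "\<forall>\<^sub>F N in sequentially. C * log 2 (real N) powr (\<delta> / 2) \<le> log 2 (real N) powr \<delta>"
proof -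
  have "\<forall>\<^sub>F N in sequentially. C \<le> log 2 (real N) powr (\<delta> / 2)"
    using assms by real_asymp
  then show ?thesis
  proof eventually_elim
    case (elim N)
    have "log 2 (real N) powr \<delta> = log 2 (real N) powr (\<delta> / 2) * log 2 (real N) powr (\<delta> / 2)"
      by (simp flip: powr_add)
    then show ?case using elim by (simp add: mult_right_mono)
  qed
qed

lemma exp_log_o1_mult_power:
  assumes "exp_log_o1 f" "\<And>N. 0 \<le> f N"
  shows "exp_log_o1 (\<lambda>N. a * f N ^ b)"
proof (rule exp_log_o1I)
  fix \<delta> :: real assume d: "\<delta> > 0"
  \<comment> \<open>A constant factor of at most \<open>2 ^ m\<close> becomes a summand in the
    exponent.\<close>
  define m where "m = nat \<lceil>\<bar>a\<bar>\<rceil>"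
  have "\<delta> / 2 > 0" using d by simp
  from exp_log_o1D[OF assms(1) this] eventually_mult_powr_log_le[OF d, of "real m + real b"]
    eventually_log2_ge[of 1]
  show "\<forall>\<^sub>F N in sequentially. a * f N ^ b \<le> 2 powr (log 2 (real N) powr \<delta>)"
  proof eventually_elim
    case (elim N)
    let ?y = "log 2 (real N) powr (\<delta> / 2)"
    have y: "1 \<le> ?y" using elim d by (intro ge_one_powr_ge_zero) auto
    have "\<bar>a\<bar> \<le> real m" unfolding m_def by linarith
    also have "\<dots> \<le> 2 powr real m"
      using of_nat_less_two_power[of m, where 'a = real] by (simp add: powr_realpow)
    also have "\<dots> \<le> 2 powr (real m * ?y)" using y by (intro powr_mono) (auto simp: mult_le_cancel_left1)
    finally have a: "\<bar>a\<bar> \<le> 2 powr (real m * ?y)" .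
    have "f N ^ b \<le> (2 powr ?y) ^ b" using elim assms(2) by (intro power_mono) auto
    also have "\<dots> = 2 powr (real b * ?y)" by (simp add: powr_power mult.commute)
    finally have "\<bar>a\<bar> * f N ^ b \<le> 2 powr (real m * ?y) * 2 powr (real b * ?y)"
      using a assms(2) by (intro mult_mono) auto
    also have "\<dots> = 2 powr ((real m + real b) * ?y)" by (simp add: algebra_simps flip: powr_add)
    also have "\<dots> \<le> 2 powr (log 2 (real N) powr \<delta>)" using elim by (intro powr_mono) auto
    finally have "\<bar>a\<bar> * f N ^ b \<le> 2 powr (log 2 (real N) powr \<delta>)" .
    moreover have "a * f N ^ b \<le> \<bar>a\<bar> * f N ^ b" using assms(2) by (intro mult_right_mono) auto
    ultimately show ?case by linarith
  qed
qed

text \<open>The single exponent \<open>1 / 2\<close> suffices: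
  \<open>2 powr (log 2 N powr (1 / 2))\<close> grows more slowly than every positive power of
  \<open>N\<close>.\<close>

lemma near_linear_mult_exp_log_o1:
  assumes "exp_log_o1 f" "\<And>N. 0 \<le> f N"
  shows "near_linear (\<lambda>N. f N * ((real N + 1) * (log 2 (real N + 1) + 1)))"
proof (rule near_linearI)
  fix \<delta> :: real assume d: "\<delta> > 0"
  have "\<forall>\<^sub>F N in sequentially. 2 powr (log 2 (real N) powr (1 / 2)) *
      ((real N + 1) * (log 2 (real N + 1) + 1)) \<le> real N powr (1 + \<delta>)"
    using d by real_asymp
  moreover have "\<forall>\<^sub>F N in sequentially. f N \<le> 2 powr (log 2 (real N) powr (1 / 2))"
    using exp_log_o1D[OF assms(1)] by simp
  ultimately show "\<forall>\<^sub>F N in sequentially.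
      f N * ((real N + 1) * (log 2 (real N + 1) + 1)) \<le> real N powr (1 + \<delta>)"
  proof eventually_elim
    case (elim N)
    have "f N * ((real N + 1) * (log 2 (real N + 1) + 1)) \<le>
        2 powr (log 2 (real N) powr (1 / 2)) * ((real N + 1) * (log 2 (real N + 1) + 1))"
      using elim by (intro mult_right_mono) auto
    then show ?case using elim by linarith
  qed
qed

section \<open>The reduction\<close>

text \<open>The logarithm of \<open>n\<close> is \<open>O(y)\<close>, the space is
  \<open>O(y ^ k)\<close>, and the eighth power of the radix multiplies both effects by a constant.
  Since \<open>1 \<le> y\<close>, the power \<open>y ^ (k + 1)\<close> dominates \<open>y\<close>
  and \<open>y ^ k\<close> alike, also for \<open>k = 0\<close>.\<close>

lemma layers_le:
  assumes "2 \<le> B" "1 \<le> y" "real n \<le> 2 powr y"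
  shows "real (layers B (space_bound c k n) n) \<le>
           2 powr (real (4 + 8 * (B + 4) + 8 * B * (c * 4 ^ k + c)) * y ^ (k + 1))"
proof -
  let ?l = "log_ceil n" and ?S = "space_bound c k n" and ?D = "c * 4 ^ k + c"
  let ?K = "radix B ?S n"
  have y2: "2 \<le> 2 powr y" using powr_mono[OF assms(2), of 2] by simp
  have "2 powr real ?l = real (2 ^ ?l)" by (simp add: powr_realpow)
  also have "\<dots> \<le> real (4 * n + 1)" using power_log_ceil_le of_nat_le_iff by blast
  also have "\<dots> \<le> 8 * 2 powr y" using assms y2 by simp
  also have "\<dots> = 2 powr (y + 3)" by (simp add: powr_add)
  finally have "real ?l \<le> y + 3" by simp
  then have l: "real ?l \<le> 4 * y" using assms by simp
  have yk: "1 \<le> y ^ k" using assms by (simp add: one_le_power)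
  have "real ?S = c * real ?l ^ k + c" by (simp add: space_bound_def)
  also have "\<dots> \<le> c * (4 * y) ^ k + c" using l by (intro add_right_mono mult_left_mono power_mono) auto
  also have "\<dots> = c * 4 ^ k * y ^ k + c * 1" by (simp add: power_mult_distrib)
  also have "\<dots> \<le> c * 4 ^ k * y ^ k + c * y ^ k" 
    using mult_left_mono[OF yk, of "real c"] by simp
  also have "\<dots> = ?D * y ^ k" by (simp add: algebra_simps)
  finally have S: "real ?S \<le> ?D * y ^ k" .
  have two: "real m \<le> 2 powr real m" for m
    using of_nat_less_two_power[of m, where 'a = real] by (simp add: powr_realpow)
  have sum: "u + v \<le> u * v" if "2 \<le> u" "2 \<le> v" for u v :: real
  proof -
    have "0 \<le> (u - 1) * (v - 1) - 1" using that mult_mono[of 1 "u - 1" 1 "v - 1"] by simp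
    then show ?thesis by (simp add: algebra_simps)
  qed
  have "real (2 * n + 2 + B) \<le> 2 * 2 powr y + 2 powr real (B + 2)"
    using assms two[of "B + 2"] by simp
  also have "\<dots> \<le> 2 * 2 powr y * 2 powr real (B + 2)"
    using y2 two[of "B + 2"] by (intro sum) auto
  also have "\<dots> = 2 powr (y + B + 3)" by (simp add: powr_add)
  finally have k1: "real (2 * n + 2 + B) \<le> 2 powr (y + B + 3)" .
  have "real (B ^ ?S) \<le> (2 powr real B) ^ ?S" using two[of B] by (simp add: power_mono)
  also have "\<dots> = 2 powr (B * real ?S)" by (simp add: powr_power mult.commute)
  also have "\<dots> \<le> 2 powr (B * (?D * y ^ k))" using S by (intro powr_mono mult_left_mono) auto
  finally have "real (B ^ ?S) \<le> 2 powr (B * (?D * y ^ k))" .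
  then have "real ?K \<le> 2 powr (y + B + 3) * 2 powr (B * (?D * y ^ k))"
    unfolding radix_def of_nat_mult using k1 by (intro mult_mono) auto
  also have "\<dots> = 2 powr (y + B + 3 + B * (?D * y ^ k))" by (simp flip: powr_add)
  finally have K: "real ?K \<le> 2 powr (y + B + 3 + B * (?D * y ^ k))" .
  have K1: "1 \<le> ?K" using assms by (simp add: radix_def Suc_le_eq)
  have "width B ?S n * width B ?S n = ?K ^ 8" by (simp add: width_def numeral_eq_Suc)
  then have "layers B ?S n = 2 + (2 * n + 2) * ?K ^ 8" by (simp add: layers_def)
  also have "\<dots> \<le> (2 * n + 4) * ?K ^ 8" using one_le_power[OF K1, of 8] by (simp add: algebra_simps)
  finally have "layers B ?S n \<le> (2 * n + 4) * ?K ^ 8" .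
  from of_nat_mono[OF this, where 'a = real]
  have "real (layers B ?S n) \<le> real (2 * n + 4) * real ?K ^ 8"
    by (simp only: of_nat_mult of_nat_power)
  also have "\<dots> \<le> 2 powr (y + 2) * (2 powr (y + B + 3 + B * (?D * y ^ k))) ^ 8"
    using assms y2 K by (intro mult_mono power_mono) (auto simp: powr_add)
  also have "\<dots> = 2 powr (y + 2 + 8 * (y + B + 3 + B * (?D * y ^ k)))"
    by (simp add: powr_power powr_add[symmetric] mult.commute)
  \<comment> \<open>The constant collects \<open>y + 2\<close>, which is at most
    \<open>3 * y ^ (k + 1)\<close> and rounded up to 4, then eight times \<open>y + B + 3\<close>,
    and eight times \<open>B * ?D\<close>.\<close>
  also have "\<dots> \<le> 2 powr (real (4 + 8 * (B + 4) + 8 * B * ?D) * y ^ (k + 1))"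
  proof (intro powr_mono)
    have a: "y \<le> y ^ (k + 1)" "1 \<le> y ^ (k + 1)" 
      using self_le_power[OF assms(2), of "k + 1"] one_le_power[OF assms(2), of "k + 1"] by auto
    have b: "y ^ k \<le> y ^ (k + 1)" using assms by (intro power_increasing) auto
    have "8 * real B * 1 \<le> 8 * real B * y ^ (k + 1)" using a by (intro mult_left_mono) auto
    moreover have "8 * real B * ?D * y ^ k \<le> 8 * real B * ?D * y ^ (k + 1)"
      using b by (intro mult_left_mono) auto
    ultimately have "y + 2 + (8 * y + 8 * real B + 24 + 8 * real B * ?D * y ^ k) \<le>
      y ^ (k + 1) + 2 * y ^ (k + 1) + (8 * y ^ (k + 1) + 8 * real B * y ^ (k + 1) + 24 * y ^ (k + 1)
        + 8 * real B * ?D * y ^ (k + 1))" using a by linarith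
    also have "\<dots> \<le> real (4 + 8 * (B + 4) + 8 * B * ?D) * y ^ (k + 1)"
      using a by (simp add: algebra_simps)
    finally show "y + 2 + 8 * (y + B + 3 + B * (?D * y ^ k)) \<le>
        real (4 + 8 * (B + 4) + 8 * B * ?D) * y ^ (k + 1)"
      by (simp add: algebra_simps)
  qed simp
  finally show ?thesis .
qed

lemma exp_log_o1_layers:
  assumes "2 \<le> B" "exp_log_o1 (\<lambda>N. real (len_of N))"
  shows "exp_log_o1 (\<lambda>N. real (layers B (space_bound c k (len_of N)) (len_of N)))"
proof (rule exp_log_o1I)
  fix \<delta> :: real assume d: "\<delta> > 0"
  \<comment> \<open>Chosen so that the power \<open>k + 1\<close> of \<open>log 2 N powr e\<close>
    is \<open>log 2 N powr (\<delta> / 2)\<close>; the other half of \<open>\<delta>\<close> absorbs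
    \<open>?C\<close>.\<close>
  define e where "e = \<delta> / (2 * (real k + 1))"
  have e: "e > 0" using d by (simp add: e_def)
  let ?C = "real (4 + 8 * (B + 4) + 8 * B * (c * 4 ^ k + c))"
  from exp_log_o1D[OF assms(2) e] eventually_mult_powr_log_le[OF d, of ?C] eventually_log2_ge[of 1]
  show "\<forall>\<^sub>F N in sequentially. real (layers B (space_bound c k (len_of N)) (len_of N))
      \<le> 2 powr (log 2 (real N) powr \<delta>)"
  proof eventually_elim
    case (elim N)
    let ?L = "log 2 (real N)"
    have "1 \<le> ?L powr e" using elim e by (intro ge_one_powr_ge_zero) auto
    from layers_le[OF assms(1) this elim(1)]
    have "real (layers B (space_bound c k (len_of N)) (len_of N)) \<le> 2 powr (?C * (?L powr e) ^ (k + 1))" .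
    also have "(?L powr e) ^ (k + 1) = ?L powr (\<delta> / 2)"
    proof -
      have "real (k + 1) * e = \<delta> / 2" by (simp add: e_def field_simps)
      then show ?thesis using elim by (simp only: powr_power)
    qed
    also have "2 powr (?C * ?L powr (\<delta> / 2)) \<le> 2 powr (?L powr \<delta>)"
      using elim(2) by (intro powr_mono) auto
    finally show ?case .
  qed
qed

lemma len_le_log: "1 \<le> v \<Longrightarrow> real (len v) \<le> 1 + log 2 (real v)"
  by (auto simp: len_def floorlog_def)

text \<open>The dependence on \<open>N\<close> has to remain logarithmic, while a factor
  \<open>E\<close> is affordable; hence the crude estimate of \<open>log 2 E\<close> by
  \<open>E\<close>.\<close>

lemma unit_cost_le:
  assumes "1 \<le> E"
  shows "real (unit_cost Z (N + E + 2 * Z + 2)) \<le>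
           real ((2 * Z + 6) * 5 * (1 + Z * (2 * Z + 5))) * (real E * (log 2 (real N + 1) + 1))"
proof -
  let ?X = "N + E + 2 * Z + 2" and ?L = "log 2 (real N + 1)"
  have "?X \<le> (N + 1) * E * (2 * Z + 3)"
  proof -
    have "?X \<le> (N + 1) + (E - 1) + (2 * Z + 2)" using assms by simp
    also have "\<dots> \<le> (N + 1) * E * (2 * Z + 3)"
    proof -
      obtain E' where "E = Suc E'" using assms by (cases E) auto
      then show ?thesis by (simp add: algebra_simps)
    qed
    finally show ?thesis .
  qed
  from of_nat_mono[OF this, where 'a = real]
  have "real ?X \<le> real (N + 1) * real E * real (2 * Z + 3)" by (simp only: of_nat_mult)
  also have "real (N + 1) = real N + 1" by simp
  finally have "real ?X \<le> (real N + 1) * real E * real (2 * Z + 3)" .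
  then have "log 2 (real ?X) \<le> log 2 ((real N + 1) * real E * real (2 * Z + 3))"
    by (subst log_le_cancel_iff) auto
  also have "\<dots> = ?L + log 2 (real E) + log 2 (real (2 * Z + 3))"
    using assms by (simp add: log_mult)
  also have "\<dots> \<le> ?L + real E + real (2 * Z + 3)"
  proof -
    have "log 2 (real m) \<le> real m" if "1 \<le> m" for m
      using that of_nat_less_two_power[of m, where 'a = real] by (simp add: log_le_iff powr_realpow)
    from this[of E] this[of "2 * Z + 3"] show ?thesis using assms by simp
  qed
  finally have X: "log 2 (real ?X) \<le> ?L + real E + real (2 * Z + 3)" .
  have L: "0 \<le> ?L" by simp
  have E1: "1 \<le> real E" using assms by simp
  have EL: "1 \<le> real E * (?L + 1)" using mult_mono[OF E1, of 1 "?L + 1"] L by simp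
  have "?L \<le> real E * ?L" using mult_right_mono[OF E1 L] by simp
  then have "?L + real E \<le> real E * (?L + 1)" by (simp add: algebra_simps)
  moreover have "real (2 * Z + 3) \<le> real (2 * Z + 3) * (real E * (?L + 1))"
    using mult_left_mono[OF EL, of "real (2 * Z + 3)"] by simp
  ultimately have X2: "log 2 (real ?X) \<le> real (2 * Z + 5) * (real E * (?L + 1))"
    using X EL by (simp add: algebra_simps)
  have "real (len (?X ^ Z)) \<le> 1 + log 2 (real (?X ^ Z))" by (rule len_le_log) simp
  also have "\<dots> = 1 + real Z * log 2 (real ?X)" by (simp add: log_nat_power)
  also have "\<dots> \<le> real E * (?L + 1) + real Z * (real (2 * Z + 5) * (real E * (?L + 1)))"
    using X2 EL by (intro add_mono mult_left_mono) auto
  also have "\<dots> = real (1 + Z * (2 * Z + 5)) * (real E * (?L + 1))" by (simp add: algebra_simps)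
  finally have "real (len (?X ^ Z)) \<le> real (1 + Z * (2 * Z + 5)) * (real E * (?L + 1))" .
  then have "real ((2 * Z + 6) * 5) * real (len (?X ^ Z)) \<le>
      real ((2 * Z + 6) * 5) * (real (1 + Z * (2 * Z + 5)) * (real E * (?L + 1)))"
    by (intro mult_left_mono) auto
  then show ?thesis unfolding unit_cost_def by (simp only: of_nat_mult mult.assoc)
qed

lemma pair_language_append:
  "length a = length b \<Longrightarrow> a @ b \<in> pair_language R \<longleftrightarrow> R a b"
proof
  assume l: "length a = length b" and "a @ b \<in> pair_language R"
  then obtain a' b' where ab: "a @ b = a' @ b'" "length a' = length b'" "R a' b'"
    unfolding pair_language_def by auto
  from arg_cong[OF ab(1), of length] have "length a = length a'" using l ab(2) by simp
  then show "R a b" using ab by simp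
qed (auto simp: pair_language_def)

text \<open>The machine reads both strings, so its space bound involves \<open>2 * n\<close>. For
  \<open>n = 0\<close> the default \<open>log 2 0 = 0\<close> is used.\<close>

lemma log_le_log_ceil: "log 2 (real (2 * n)) \<le> real (log_ceil n)"
proof (cases "n = 0")
  case False
  have "real (2 * n) \<le> 2 powr real (log_ceil n)"
    using of_nat_mono[OF le_power_log_ceil[of n], where 'a = real] by (simp add: powr_realpow)
  then show ?thesis using False by (subst log_le_iff) auto
qed (simp add: log_def)

lemma ntm_bound:
  assumes "wf_ntm M"
  obtains B where "2 \<le> B" "ntm_start M < B"
    "\<And>q s g q' g' d d'. (q, s, g, q', g', d, d') \<in> ntm_delta M \<Longrightarrow> q' < B \<and> g' < B"
proof -
  let ?f = "\<lambda>(q, s, g, q', g', d, d'). q' + g'"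
  have "finite (?f ` ntm_delta M)" using assms by (simp add: wf_ntm_def)
  then obtain m where m: "\<forall>x\<in>?f ` ntm_delta M. x < m" using finite_nat_set_iff_bounded by auto
  show ?thesis
  proof (rule that[of "m + ntm_start M + 2"])
    fix q s g q' g' d d' assume "(q, s, g, q', g', d, d') \<in> ntm_delta M"
    with m have "q' + g' < m" by force
    then show "q' < m + ntm_start M + 2 \<and> g' < m + ntm_start M + 2" by simp
  qed auto
qed

theorem theorem4p1:
  fixes \<A> :: "bool list \<Rightarrow> bool list \<Rightarrow> bool"
    and len_of :: "nat \<Rightarrow> nat"
  assumes "pair_language \<A> \<in> NSPACE_polylog"
    and "exp_log_o1 (\<lambda>N. real (len_of N))"
  shows "\<exists>(p :: instr list) (time :: nat \<Rightarrow> real) (size :: nat \<Rightarrow> real).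
           near_linear time \<and> exp_log_o1 size \<and>
           (\<forall>N A B xs. encodes_sets N (len_of N) A B xs \<longrightarrow>
              (\<exists>ys t P A' B'.
                 ram_computes p xs ys t \<and> real t \<le> time N \<and>
                 encodes_bp_sets N P A' B' ys \<and> real (bp_size P) \<le> size N \<and>
                 (satisfying_pair \<A> A B \<longleftrightarrow> bp_satisfying_pair P A' B')))"
proof -
  obtain k c where "pair_language \<A> \<in> NSPACE (\<lambda>n. real c * (log 2 (real n)) ^ k + real c)"
    using assms(1) unfolding NSPACE_polylog_def by blast
  then obtain M where wf: "wf_ntm M" and dec: "\<And>x. x \<in> pair_language \<A> \<longleftrightarrow> ntm_accepts M x"
    and sp: "\<And>x q i h w. ntm_reachable M x (q, i, h, w) \<Longrightarrow>
      real (h + 1) \<le> real c * (log 2 (real (length x))) ^ k + real c"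
    unfolding NSPACE_def by blast
  obtain D where D: "2 \<le> D" "ntm_start M < D"
    "\<And>q s g q' g' d d'. (q, s, g, q', g', d, d') \<in> ntm_delta M \<Longrightarrow> q' < D \<and> g' < D"
    using ntm_bound[OF wf] by blast
  obtain trs where trs: "set trs = ntm_delta M"
    using finite_list wf unfolding wf_ntm_def by blast
  define C where "C = reduction_cmd M D c k trs"
  define Z where "Z = csize C"
  define S where "S N = space_bound c k (len_of N)" for N
  define E where "E N = layers D (S N) (len_of N)" for N
  define a where "a = 100 * real ((2 * Z + 6) * 5 * (1 + Z * (2 * Z + 5)))"
  \<comment> \<open>The fourth power is \<open>E ^ 3\<close> units times the factor \<open>E\<close>
    of the unit cost. The cost bound is claimed for every \<open>N\<close>, including 0, hence
    \<open>N + 1\<close>.\<close>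
  define time where "time N = a * real (E N) ^ 4 * ((real N + 1) * (log 2 (real N + 1) + 1))" for N
  define size where "size N = 2 * real (E N) ^ 3" for N
  have oE: "exp_log_o1 (\<lambda>N. real (E N))"
    unfolding E_def S_def by (rule exp_log_o1_layers[OF D(1) assms(2)])
  have "near_linear time" unfolding time_def
    by (rule near_linear_mult_exp_log_o1[OF exp_log_o1_mult_power[OF oE]]) (auto simp: a_def)
  moreover have "exp_log_o1 size" unfolding size_def by (rule exp_log_o1_mult_power[OF oE]) simp
  moreover have "\<exists>ys t P A' B'. ram_computes (compile C 0 Z) xs ys t \<and> real t \<le> time N \<and>
        encodes_bp_sets N P A' B' ys \<and> real (bp_size P) \<le> size N \<and>
        (satisfying_pair \<A> A B \<longleftrightarrow> bp_satisfying_pair P A' B')"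
    if enc: "encodes_sets N (len_of N) A B xs" for N A B xs
  proof -
    let ?n = "len_of N"
    define P where "P = sim_bp M D (S N) ?n"
    let ?A = "(#) False ` A" and ?B = "(\<lambda>b. b @ [False]) ` B"
    obtain as bs where ab: "distinct as" "set as = A" "distinct bs" "set bs = B"
      "xs = [N, ?n] @ bits as @ bits bs"
      and sA: "string_set N ?n A" and sB: "string_set N ?n B"
      using enc unfolding encodes_sets_def by blast
    have lens: "length as = N" "length bs = N" "\<forall>a\<in>set as. length a = ?n" "\<forall>a\<in>set bs. length a = ?n"
      using ab sA sB distinct_card[of as] distinct_card[of bs] by (auto simp: string_set_def)
    let ?ys = "bp_code P @ [N, ?n + 1] @ bits (map ((#) False) as) @ bits (map (\<lambda>b. b @ [False]) bs)"
    note bd = layers_bounds[OF D(1), where S = "S N" and n = ?n, folded E_def]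
    have E1: "1 \<le> E N" using bd by simp
    obtain t where t: "ram_computes (compile C 0 Z) xs ?ys t"
      "t \<le> 100 * (N + 1) * E N ^ 3 * unit_cost Z (N + E N + 2 * Z + 2)"
      using reduction_cmd_computes[OF D(1) trs lens, of c k]
      unfolding ab(5) C_def Z_def S_def E_def P_def by blast
    have "real t \<le> real (100 * (N + 1) * E N ^ 3 * unit_cost Z (N + E N + 2 * Z + 2))"
      using t(2) of_nat_le_iff by blast
    also have "\<dots> = 100 * (real N + 1) * real (E N) ^ 3 * real (unit_cost Z (N + E N + 2 * Z + 2))"
      by simp
    also have "\<dots> \<le> 100 * (real N + 1) * real (E N) ^ 3 *
        (real ((2 * Z + 6) * 5 * (1 + Z * (2 * Z + 5))) * (real (E N) * (log 2 (real N + 1) + 1)))"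
      using unit_cost_le[OF E1] by (intro mult_left_mono) auto
    also have "\<dots> = time N"
    proof -
      have "100 * p * e ^ 3 * (q * (e * l)) = 100 * q * e ^ 4 * (p * l)" for p e q l :: real
        by (simp add: numeral_eq_Suc mult_ac)
      then show ?thesis unfolding time_def a_def .
    qed
    finally have time: "real t \<le> time N" .
    have sA': "string_set N (?n + 1) ?A" and sB': "string_set N (?n + 1) ?B"
      using sA sB by (auto simp: string_set_def card_image inj_on_def)
    have "encodes_sets N (?n + 1) ?A ?B
        ([N, ?n + 1] @ bits (map ((#) False) as) @ bits (map (\<lambda>b. b @ [False]) bs))"
      unfolding encodes_sets_def using sA' sB' ab
      by (intro conjI exI[of _ "map ((#) False) as"] exI[of _ "map (\<lambda>b. b @ [False]) bs"])
        (auto simp: distinct_map inj_on_def)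
    then have encP: "encodes_bp_sets N P ?A ?B ?ys"
      unfolding encodes_bp_sets_def using wf_sim_bp[OF D(1), of M "S N" ?n]
      by (intro conjI exI[of _ "?n + 1"]) (auto simp: P_def sim_bp_def)
    have "bp_size P \<le> E N * (width D (S N) ?n * (width D (S N) ?n * 2))"
      unfolding P_def E_def by (rule bp_size_sim_bp)
    also have "\<dots> \<le> E N * (E N * (E N * 2))" using bd by (intro mult_le_mono) auto
    finally have "real (bp_size P) \<le> real (E N * (E N * (E N * 2)))" using of_nat_le_iff by blast
    then have size: "real (bp_size P) \<le> size N" by (simp add: size_def power3_eq_cube mult_ac)
    have "bp_accepts P ((False # a) @ (b @ [False])) \<longleftrightarrow> \<A> a b" if "a \<in> A" "b \<in> B" for a b
    proof -
      have l: "length a = ?n" "length b = ?n" using that sA sB by (auto simp: string_set_def)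
      \<comment> \<open>The machine is bounded by a power of a real logarithm; it is rounded up to
        the number of cells \<open>S N\<close> that the program computes.\<close>
      interpret bounded_ntm M D "S N" ?n "a @ b"
      proof
        fix q i h w assume r: "ntm_reachable M (a @ b) (q, i, h, w)"
        have len: "length (a @ b) = 2 * ?n" using l by simp
        have nonneg: "0 \<le> log 2 (real (2 * ?n))" by (cases "?n = 0") (auto simp: log_def)
        have "real (h + 1) \<le> real c * (log 2 (real (2 * ?n))) ^ k + real c"
          using sp[OF r] unfolding len .
        also have "\<dots> \<le> real c * real (log_ceil ?n) ^ k + real c"
          using log_le_log_ceil nonneg by (intro add_right_mono mult_left_mono power_mono) auto
        also have "\<dots> = real (S N)" by (simp add: S_def space_bound_def)
        finally show "h < S N" by simp
      qed (use D l in auto)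
      have "bp_accepts P (False # (a @ b) @ [False]) \<longleftrightarrow> ntm_accepts M (a @ b)"
        unfolding P_def using sim_bp_sound sim_bp_complete by blast
      also have "\<dots> \<longleftrightarrow> \<A> a b" using dec[of "a @ b"] pair_language_append[of a b] l by simp
      finally show ?thesis by simp
    qed
    then have "satisfying_pair \<A> A B \<longleftrightarrow> bp_satisfying_pair P ?A ?B"
      unfolding bp_satisfying_pair_def satisfying_pair_def by auto
    with t(1) time encP size show ?thesis by blast
  qed
  ultimately show ?thesis by blast
qed

end
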